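(* Let $H$ be a group, let $\phi\in\operatorname{Aut}(H)$ and let $K$ be a proper subgroup of $H$ such that $K$ is a proper subgroup of its normalizer $N_H(K)$. Let $G=H\ast_{(K,\phi)}=\langle H, t;\ tkt^{-1}=\phi(k),\ k\in K\rangle$. Suppose that $G$ is hyperbolic and not residually finite. Then $K$ is finite, and $H$ is hyperbolic and not residually finite.
   Context: For a group $H$, $\phi\in\operatorname{Aut}(H)$ and a proper subgroup $K\lneq H$, the automorphism-induced HNN-extension $H\ast_{(K,\phi)}$ is the group given by the relative presentation $\langle H, t;\ tkt^{-1}=\phi(k),\ k\in K\rangle$. Hyperbolic means word-hyperbolic in the sense of Gromov (in particular finitely generated). *)

theory Defs
  imports "HOL-Algebra.Algebra"
begin

text \<open>Letters of the free group on (carrier H) plus one extra generator t.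
  A letter is (x, e): x = None stands for t, x = Some h for the generator h;
  e = True means the formal inverse of that generator.\<close>

type_synonym 'a hnn_letter = "'a option \<times> bool"

definition hnn_valid_letter :: "('a, 'b) monoid_scheme \<Rightarrow> 'a hnn_letter \<Rightarrow> bool" where
  "hnn_valid_letter H l = (case fst l of None \<Rightarrow> True | Some h \<Rightarrow> h \<in> carrier H)"

definition hnn_valid :: "('a, 'b) monoid_scheme \<Rightarrow> 'a hnn_letter list \<Rightarrow> bool" where
  "hnn_valid H w = (\<forall>l \<in> set w. hnn_valid_letter H l)"

inductive hnn_rel :: "('a, 'b) monoid_scheme \<Rightarrow> ('a \<Rightarrow> 'a) \<Rightarrow> 'a set
    \<Rightarrow> 'a hnn_letter list \<Rightarrow> 'a hnn_letter list \<Rightarrow> bool"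
  for H phi K where
  refl: "hnn_valid H w \<Longrightarrow> hnn_rel H phi K w w"
| sym: "hnn_rel H phi K u v \<Longrightarrow> hnn_rel H phi K v u"
| trans: "hnn_rel H phi K u v \<Longrightarrow> hnn_rel H phi K v w \<Longrightarrow> hnn_rel H phi K u w"
| cong: "hnn_rel H phi K u v \<Longrightarrow> hnn_valid H a \<Longrightarrow> hnn_valid H b
          \<Longrightarrow> hnn_rel H phi K (a @ u @ b) (a @ v @ b)"
| free1: "hnn_valid_letter H (x, False) \<Longrightarrow> hnn_rel H phi K [(x, False), (x, True)] []"
| free2: "hnn_valid_letter H (x, False) \<Longrightarrow> hnn_rel H phi K [(x, True), (x, False)] []"
| rel_mult: "h1 \<in> carrier H \<Longrightarrow> h2 \<in> carrier H \<Longrightarrow>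
          hnn_rel H phi K [(Some h1, False), (Some h2, False)] [(Some (h1 \<otimes>\<^bsub>H\<^esub> h2), False)]"
| rel_one: "hnn_rel H phi K [(Some \<one>\<^bsub>H\<^esub>, False)] []"
| conj: "k \<in> K \<Longrightarrow>
          hnn_rel H phi K [(None, False), (Some k, False), (None, True)] [(Some (phi k), False)]"

definition hnn_class :: "('a, 'b) monoid_scheme \<Rightarrow> ('a \<Rightarrow> 'a) \<Rightarrow> 'a set
    \<Rightarrow> 'a hnn_letter list \<Rightarrow> 'a hnn_letter list set" where
  "hnn_class H phi K w = {v. hnn_rel H phi K w v}"

definition HNN :: "('a, 'b) monoid_scheme \<Rightarrow> ('a \<Rightarrow> 'a) \<Rightarrow> 'a set
    \<Rightarrow> 'a hnn_letter list set monoid" where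
  "HNN H phi K =
     \<lparr> carrier = {hnn_class H phi K w | w. hnn_valid H w},
       Group.monoid.mult = (\<lambda>A B. {v. \<exists>x\<in>A. \<exists>y\<in>B. hnn_rel H phi K (x @ y) v}),
       Group.monoid.one = hnn_class H phi K [] \<rparr>"

definition word_length :: "('g, 'b) monoid_scheme \<Rightarrow> 'g set \<Rightarrow> 'g \<Rightarrow> nat" where
  "word_length G S g =
     (LEAST n. \<exists>ws. length ws = n \<and> set ws \<subseteq> S \<union> m_inv G ` S
                    \<and> foldr (\<otimes>\<^bsub>G\<^esub>) ws \<one>\<^bsub>G\<^esub> = g)"

definition word_dist :: "('g, 'b) monoid_scheme \<Rightarrow> 'g set \<Rightarrow> 'g \<Rightarrow> 'g \<Rightarrow> nat" where
  "word_dist G S g h = word_length G S (inv\<^bsub>G\<^esub> g \<otimes>\<^bsub>G\<^esub> h)"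

definition gromov_product :: "('g, 'b) monoid_scheme \<Rightarrow> 'g set \<Rightarrow> 'g \<Rightarrow> 'g \<Rightarrow> 'g \<Rightarrow> real" where
  "gromov_product G S w x y =
     (real (word_dist G S w x) + real (word_dist G S w y) - real (word_dist G S x y)) / 2"

definition hyperbolic_group :: "('g, 'b) monoid_scheme \<Rightarrow> bool" where
  "hyperbolic_group G \<longleftrightarrow> group G \<and>
     (\<exists>S. finite S \<and> S \<subseteq> carrier G \<and> generate G S = carrier G \<and>
        (\<exists>\<delta>::real. \<forall>w\<in>carrier G. \<forall>x\<in>carrier G. \<forall>y\<in>carrier G. \<forall>z\<in>carrier G.
            gromov_product G S w x y \<ge> min (gromov_product G S w x z) (gromov_product G S w z y) - \<delta>))"

definition residually_finite :: "('g, 'b) monoid_scheme \<Rightarrow> bool" where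
  "residually_finite G \<longleftrightarrow>
     (\<forall>g\<in>carrier G. g \<noteq> \<one>\<^bsub>G\<^esub> \<longrightarrow>
        (\<exists>N. N \<lhd> G \<and> finite (rcosets\<^bsub>G\<^esub> N) \<and> g \<notin> N))"

end

theory Submission
  imports Defs
begin

text \<open>
  Finiteness of \<open>K\<close>: for \<open>n\<close> in the normalizer of \<open>K\<close> but not in \<open>K\<close>, conjugation by \<open>n\<close> and by
  \<open>t\<^sup>-\<^sup>1 \<phi>(n) t\<close> agree on \<open>K\<close>. Their quotient is an element of infinite order that centralizes \<open>K\<close>
  and no nontrivial power of which lies in \<open>K\<close>; in a hyperbolic group this forces \<open>K\<close> to be finite.

  Hyperbolicity of \<open>H\<close>: for suitable generators, an action of \<open>G\<close> on \<open>H\<close> together with reduced words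
  over \<open>K\<close>-cosets shows that \<open>H\<close> is undistorted in \<open>G\<close>, and stability of quasi-geodesics then carries
  hyperbolicity over to \<open>H\<close>.

  Residual finiteness: the same action is faithful. If \<open>H\<close> is residually finite, dividing \<open>H\<close> by a
  \<open>\<phi>\<close>-invariant subgroup of finite index and replacing the reduced words by permutations of a
  finite set gives finite quotients of \<open>G\<close> that detect any given nontrivial element.
\<close>

section \<open>Hyperbolicity of graph metrics\<close>

text \<open>What has to be known about elements of \<open>HNN H phi K\<close> is read off from
  actions. As \<open>phi\<close> is defined on all of \<open>H\<close>, letting t act as
  \<open>phi\<close> and \<open>H\<close> by left multiplication satisfies the relations on
  \<open>H\<close> itself. This action forgets too much: it factors through the semidirect product
  of \<open>H\<close> with the integers. The repair is to let t also permute a second coordinate, by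
  a permutation depending only on the coset \<open>K #> y\<close> of the current point
  \<open>y\<close>; the relation survives because \<open>y\<close> and \<open>k \<otimes> y\<close>
  lie in one coset. With integers as second coordinate the action detects an element of infinite
  order, with reduced words over cosets it loses nothing, with a finite set it yields finite
  quotients.

  The finiteness of \<open>K\<close> carries the rest: it lets \<open>K\<close> and its image under
  \<open>phi\<close> join a finite generating set of \<open>H\<close>, and it leaves only finitely
  many elements that a finite quotient of \<open>H\<close> must keep nontrivial. The finite
  generation of \<open>H\<close> obtained on the way is what makes subgroups of finite index
  invariant under \<open>phi\<close> available.\<close>

definition four_point :: "'x set \<Rightarrow> ('x \<Rightarrow> 'x \<Rightarrow> nat) \<Rightarrow> real \<Rightarrow> bool" where
  "four_point M d \<delta> \<longleftrightarrow> (\<forall>w\<in>M. \<forall>x\<in>M. \<forall>y\<in>M. \<forall>z\<in>M.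
     real (d x y) + real (d w z) \<le> max (real (d w y) + real (d x z)) (real (d w x) + real (d z y)) + 2 * \<delta>)"

lemma four_pointD:
  assumes "four_point M d \<delta>" "w \<in> M" "x \<in> M" "y \<in> M" "z \<in> M"
  shows "real (d x y) + real (d w z) \<le> max (real (d w y) + real (d x z)) (real (d w x) + real (d z y)) + 2 * \<delta>"
  using assms unfolding four_point_def by blast

lemma four_point_mono: "four_point M d \<delta> \<Longrightarrow> \<delta> \<le> \<delta>' \<Longrightarrow> four_point M d \<delta>'"
  unfolding four_point_def by fastforce

text \<open>\<open>dist_step\<close> separates a graph metric from an arbitrary integer-valued one:
  it supplies discrete geodesics, which take the place of paths parametrized by real
  intervals.\<close>

locale graph_metric =
  fixes M :: "'x set" and d :: "'x \<Rightarrow> 'x \<Rightarrow> nat"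
  assumes dist_self: "x \<in> M \<Longrightarrow> d x x = 0"
    and dist_sym: "x \<in> M \<Longrightarrow> y \<in> M \<Longrightarrow> d x y = d y x"
    and dist_triangle: "x \<in> M \<Longrightarrow> y \<in> M \<Longrightarrow> z \<in> M \<Longrightarrow> d x z \<le> d x y + d y z"
    and dist_eq_0: "x \<in> M \<Longrightarrow> y \<in> M \<Longrightarrow> d x y = 0 \<Longrightarrow> x = y"
    and dist_step: "x \<in> M \<Longrightarrow> y \<in> M \<Longrightarrow> d x y = Suc n \<Longrightarrow> \<exists>z\<in>M. d x z = 1 \<and> d z y = n"
begin

definition geod :: "(nat \<Rightarrow> 'x) \<Rightarrow> 'x \<Rightarrow> 'x \<Rightarrow> bool" where
  "geod \<gamma> x y \<longleftrightarrow> \<gamma> 0 = x \<and> \<gamma> (d x y) = y \<and> (\<forall>i\<le>d x y. \<gamma> i \<in> M)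
     \<and> (\<forall>i j. i \<le> j \<longrightarrow> j \<le> d x y \<longrightarrow> d (\<gamma> i) (\<gamma> j) = j - i)"

lemma path_dist_le:
  assumes "\<forall>i\<le>n. \<gamma> i \<in> M" "\<forall>i<n. d (\<gamma> i) (\<gamma> (Suc i)) \<le> L" "i \<le> j" "j \<le> n"
  shows "d (\<gamma> i) (\<gamma> j) \<le> L * (j - i)"
  using assms(3,4)
proof (induction j)
  case 0
  then show ?case using assms(1) dist_self by auto
next
  case (Suc j)
  show ?case
  proof (cases "i = Suc j")
    case True
    then show ?thesis using assms(1) dist_self Suc by auto
  next
    case False
    then have "i \<le> j" using Suc by simp
    have "d (\<gamma> i) (\<gamma> (Suc j)) \<le> d (\<gamma> i) (\<gamma> j) + d (\<gamma> j) (\<gamma> (Suc j))"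
      using assms(1) Suc.prems by (intro dist_triangle) auto
    also have "\<dots> \<le> L * (j - i) + L" using Suc assms(2) \<open>i \<le> j\<close> by (intro add_mono) auto
    finally show ?thesis using \<open>i \<le> j\<close> by (simp add: Suc_diff_le)
  qed
qed

lemma geod_exists:
  assumes "x \<in> M" "y \<in> M"
  shows "\<exists>\<gamma>. geod \<gamma> x y"
proof -
  have "\<exists>\<gamma>. \<gamma> 0 = x \<and> \<gamma> n = y \<and> (\<forall>i\<le>n. \<gamma> i \<in> M) \<and> (\<forall>i<n. d (\<gamma> i) (\<gamma> (Suc i)) \<le> 1)"
    if "d x y = n" "x \<in> M" for n x
    using that
  proof (induction n arbitrary: x)
    case 0
    then have "x = y" using dist_eq_0 assms by blast
    then show ?case using assms by (intro exI[of _ "\<lambda>_. y"]) auto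
  next
    case (Suc n)
    then obtain z where z: "z \<in> M" "d x z = 1" "d z y = n" using dist_step[OF Suc.prems(2) assms(2) Suc.prems(1)] by blast
    then obtain \<gamma> where g: "\<gamma> 0 = z" "\<gamma> n = y" "\<forall>i\<le>n. \<gamma> i \<in> M" "\<forall>i<n. d (\<gamma> i) (\<gamma> (Suc i)) \<le> 1"
      using Suc.IH[OF z(3,1)] by blast
    define \<eta> where "\<eta> i = (case i of 0 \<Rightarrow> x | Suc j \<Rightarrow> \<gamma> j)" for i
    have \<eta>: "\<eta> 0 = x" "\<And>j. \<eta> (Suc j) = \<gamma> j" unfolding \<eta>_def by simp_all
    have "\<eta> i \<in> M" if "i \<le> Suc n" for i
      using that \<eta> g(3) Suc.prems(2) by (cases i) simp_all
    moreover have "d (\<eta> i) (\<eta> (Suc i)) \<le> 1" if "i < Suc n" for i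
      using that \<eta> g(1,4) z(2) by (cases i) simp_all
    moreover have "\<eta> (Suc n) = y" using \<eta> g(2) by simp
    ultimately show ?case using \<eta>(1) by blast
  qed
  then obtain \<gamma> where g: "\<gamma> 0 = x" "\<gamma> (d x y) = y" "\<forall>i\<le>d x y. \<gamma> i \<in> M"
      "\<forall>i<d x y. d (\<gamma> i) (\<gamma> (Suc i)) \<le> 1"
    using assms by blast
  have "d (\<gamma> i) (\<gamma> j) = j - i" if ij: "i \<le> j" "j \<le> d x y" for i j
  proof (rule antisym)
    show "d (\<gamma> i) (\<gamma> j) \<le> j - i" using path_dist_le[OF g(3,4) ij] by simp
    \<comment> \<open>The path has only \<open>d x y\<close> steps of length at most 1, so the
      pieces before \<open>i\<close> and after \<open>j\<close> cannot make up for a middle piece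
      that is too short.\<close>
    have "d x y \<le> d x (\<gamma> i) + d (\<gamma> i) y" using g ij assms by (intro dist_triangle) auto
    also have "d (\<gamma> i) y \<le> d (\<gamma> i) (\<gamma> j) + d (\<gamma> j) y" using g ij assms by (intro dist_triangle) auto
    also have "d x (\<gamma> i) \<le> i" using path_dist_le[OF g(3,4), of 0 i] ij g(1) by simp
    also have "d (\<gamma> j) y \<le> d x y - j" using path_dist_le[OF g(3,4), of j "d x y"] ij g(2) by simp
    finally show "j - i \<le> d (\<gamma> i) (\<gamma> j)" using ij by simp
  qed
  then show ?thesis unfolding geod_def using g by blast
qed

lemma geod_between:
  assumes "geod \<gamma> x y" "i \<le> d x y"
  shows "\<gamma> i \<in> M" "d x (\<gamma> i) = i" "d (\<gamma> i) y = d x y - i"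
proof -
  show "\<gamma> i \<in> M" using assms unfolding geod_def by blast
  show "d x (\<gamma> i) = i" using assms unfolding geod_def by (metis diff_zero le0)
  show "d (\<gamma> i) y = d x y - i" using assms unfolding geod_def by (metis order_refl)
qed

section \<open>Gromov products along paths that avoid a point\<close>

definition gp :: "'x \<Rightarrow> 'x \<Rightarrow> 'x \<Rightarrow> real" where
  "gp w x y = (real (d w x) + real (d w y) - real (d x y)) / 2"

lemma four_point_gp:
  assumes "four_point M d \<delta>" "w \<in> M" "x \<in> M" "y \<in> M" "z \<in> M"
    and "R \<le> gp w x z" "R \<le> gp w z y"
  shows "R - \<delta> \<le> gp w x y"
proof -
  have "real (d x y) + real (d w z) \<le> max (real (d w y) + real (d x z)) (real (d w x) + real (d z y)) + 2 * \<delta>"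
    by (rule four_pointD[OF assms(1-5)])
  then show ?thesis using assms(6,7) unfolding gp_def by (auto simp: field_simps max_def split: if_splits)
qed

text \<open>Halving the path costs one \<open>\<delta>\<close>, so a path of \<open>n\<close> steps costs only \<open>\<delta> log n\<close>.\<close>

lemma gp_path:
  assumes hyp: "four_point M d \<delta>" "0 \<le> \<delta>" and q: "q \<in> M"
  shows "\<lbrakk>\<forall>i\<le>n. p i \<in> M; \<forall>i<n. R \<le> gp q (p i) (p (Suc i)); n \<le> 2 ^ k; 0 < n\<rbrakk>
     \<Longrightarrow> R - real k * \<delta> \<le> gp q (p 0) (p n)"
proof (induction k arbitrary: n p)
  case 0
  then have "n = 1" by simp
  then show ?case using 0 by simp
next
  case (Suc k)
  show ?case
  proof (cases "n \<le> 2 ^ k")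
    case True
    then have "R - real k * \<delta> \<le> gp q (p 0) (p n)" using Suc by blast
    then show ?thesis using hyp(2) by (simp add: algebra_simps)
  next
    case False
    define m where "m = (2 ^ k :: nat)"
    have m: "0 < m" "m < n" "n - m \<le> 2 ^ k" using False Suc.prems(3) by (auto simp: m_def)
    have 1: "R - real k * \<delta> \<le> gp q (p 0) (p m)"
      using Suc.IH[of m p] Suc.prems m m_def by auto
    have 2: "R - real k * \<delta> \<le> gp q (p m) (p n)"
      using Suc.IH[of "n - m" "\<lambda>i. p (m + i)"] Suc.prems m by auto
    have "R - real k * \<delta> - \<delta> \<le> gp q (p 0) (p n)"
      using four_point_gp[OF hyp(1) q _ _ _ 1 2] Suc.prems(1) m by auto
    then show ?thesis by (simp add: algebra_simps)
  qed
qed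

text \<open>Neighbours are at most \<open>L\<close> apart and at least \<open>D\<close> away from
  \<open>q\<close>, so one step has product at least \<open>D - L / 2\<close>; halving then costs
  \<open>k * \<delta>\<close>. Both truncated differences are bounded because the order of
  \<open>i\<close> and \<open>j\<close> is unknown where this is applied.\<close>

lemma gp_path_far:
  assumes hyp: "four_point M d \<delta>" "0 \<le> \<delta>" and q: "q \<in> M"
    and p: "\<forall>i\<le>n. p i \<in> M" "\<forall>i<n. d (p i) (p (Suc i)) \<le> L" "\<forall>i\<le>n. D \<le> d q (p i)"
    and ij: "i \<le> n" "j \<le> n" "i - j \<le> 2 ^ k" "j - i \<le> 2 ^ k"
  shows "real D - real L / 2 - real k * \<delta> \<le> gp q (p i) (p j)"
proof -
  have gsym: "gp q (p a) (p b) = gp q (p b) (p a)" if "a \<le> n" "b \<le> n" for a b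
    unfolding gp_def using dist_sym p(1) that by simp
  have main: "real D - real L / 2 - real k * \<delta> \<le> gp q (p a) (p b)"
    if ab: "a \<le> b" "b \<le> n" "b - a \<le> 2 ^ k" for a b
  proof (cases "a = b")
    case True
    then have "real D \<le> gp q (p a) (p b)" using dist_self p ab by (simp add: gp_def)
    moreover have "0 \<le> real k * \<delta>" using hyp(2) by simp
    ultimately show ?thesis by simp
  next
    case False
    have "real D - real L / 2 \<le> gp q (p (a + i)) (p (a + Suc i))" if "i < b - a" for i
    proof -
      have "d (p (a + i)) (p (Suc (a + i))) \<le> L" "D \<le> d q (p (a + i))" "D \<le> d q (p (Suc (a + i)))"
        using p ab that by auto
      then show ?thesis unfolding gp_def by (simp add: field_simps)
    qed
    then show ?thesis
      using gp_path[OF hyp q, of "b - a" "\<lambda>i. p (a + i)" "real D - real L / 2" k] p(1) ab False by auto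
  qed
  show ?thesis using main[of i j] main[of j i] gsym[of i j] ij by (cases "i \<le> j") auto
qed

text \<open>An exponential beats a linear function: the two conditions give
  \<open>2 ^ k \<le> c * (A + k * \<delta>) + 2\<close>, which bounds \<open>k\<close> and then
  \<open>D\<close>.\<close>

lemma log_bound:
  assumes "0 \<le> (\<delta>::real)" "0 \<le> (A::real)" "0 \<le> (c::real)"
  shows "\<exists>D0::nat. \<forall>D::nat. \<forall>k. real D \<le> A + real k * \<delta> \<and> 2 ^ k \<le> c * real D + 2 \<longrightarrow> D \<le> D0"
proof -
  have "(\<lambda>k. (c * (A + real k * \<delta>) + 2) * (1/2) ^ k) \<longlonglongrightarrow> 0"
  proof -
    have 1: "(\<lambda>k. real k * (1/2) ^ k) \<longlonglongrightarrow> 0" using powser_times_n_limit_0[of "1/2::real"] by simp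
    have 2: "(\<lambda>k. (1/2::real) ^ k) \<longlonglongrightarrow> 0" by (rule LIMSEQ_realpow_zero) auto
    have "(\<lambda>k. (c * A + 2) * (1/2) ^ k + c * \<delta> * (real k * (1/2) ^ k)) \<longlonglongrightarrow> (c * A + 2) * 0 + c * \<delta> * 0"
      by (intro tendsto_intros 1 2)
    then show ?thesis by (simp add: algebra_simps)
  qed
  then have "eventually (\<lambda>k. (c * (A + real k * \<delta>) + 2) * (1/2) ^ k < 1) sequentially"
    by (rule order_tendstoD) simp
  then obtain k0 where k0: "\<And>k. k0 \<le> k \<Longrightarrow> (c * (A + real k * \<delta>) + 2) * (1/2) ^ k < 1"
    by (auto simp: eventually_sequentially)
  have "D \<le> nat \<lceil>A + real k0 * \<delta>\<rceil>" if h: "real D \<le> A + real k * \<delta>" "2 ^ k \<le> c * real D + 2" for D k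
  proof -
    have "k < k0"
    proof (rule ccontr)
      assume "\<not> k < k0"
      then have "(c * (A + real k * \<delta>) + 2) * (1/2) ^ k < 1" using k0 by simp
      then have "c * (A + real k * \<delta>) + 2 < 2 ^ k" by (simp add: field_simps power_one_over)
      moreover have "c * real D \<le> c * (A + real k * \<delta>)" using h assms by (intro mult_left_mono) auto
      ultimately show False using h by simp
    qed
    then have "real k * \<delta> \<le> real k0 * \<delta>" using assms by (intro mult_right_mono) auto
    then show ?thesis using h by linarith
  qed
  then show ?thesis by blast
qed

section \<open>Stability of quasi-geodesics\<close>

definition quasi_geod :: "nat \<Rightarrow> nat \<Rightarrow> nat \<Rightarrow> (nat \<Rightarrow> 'x) \<Rightarrow> bool" where
  "quasi_geod l L n p \<longleftrightarrow> (\<forall>i\<le>n. p i \<in> M) \<and> (\<forall>i<n. d (p i) (p (Suc i)) \<le> L)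
     \<and> (\<forall>i j. i \<le> j \<longrightarrow> j \<le> n \<longrightarrow> j - i \<le> l * d (p i) (p j))"

text \<open>Let \<open>D\<close> be the largest distance of a geodesic point from the path, attained
  at \<open>?q\<close>. The part of the path that joins the two sides of \<open>?q\<close> stays at
  distance at least \<open>D\<close> from \<open>?q\<close>, so its ends have a product of about
  \<open>D\<close> minus a logarithm of its length. As \<open>?q\<close> lies on the geodesic, the
  product of geodesic points on either side is 0. The length in question is linear in
  \<open>D\<close>, so \<open>D\<close> is bounded.\<close>

lemma geod_near_quasi_geod:
  assumes hyp: "four_point M d \<delta>" "0 \<le> \<delta>"
  shows "\<exists>D0. \<forall>n p \<gamma>. quasi_geod l L n p \<longrightarrow> geod \<gamma> (p 0) (p n) \<longrightarrow>
    (\<forall>i\<le>d (p 0) (p n). \<exists>j\<le>n. d (\<gamma> i) (p j) \<le> D0)"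
proof -
  \<comment> \<open>\<open>12 * l\<close> arises from rounding the bound \<open>6 * l * D\<close> on
    the length up to a power of two; \<open>2 * \<delta>\<close> pays for passing from two path
    points to two geodesic points.\<close>
  obtain D0 where D0: "\<And>D k. real D \<le> (real L / 2 + 2 * \<delta>) + real k * \<delta> \<Longrightarrow> 2 ^ k \<le> real (12 * l) * real D + 2 \<Longrightarrow> D \<le> D0"
    using log_bound[of \<delta> "real L / 2 + 2 * \<delta>" "real (12 * l)"] hyp(2) by auto
  have "\<forall>i\<le>d (p 0) (p n). \<exists>j\<le>n. d (\<gamma> i) (p j) \<le> D0"
    if qg: "quasi_geod l L n p" and g: "geod \<gamma> (p 0) (p n)" for n p \<gamma>
  proof -
    define m where "m = d (p 0) (p n)"
    define r where "r i = Min ((\<lambda>j. d (\<gamma> i) (p j)) ` {..n})" for i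
    define D where "D = Max (r ` {..m})"
    have pX: "\<And>i. i \<le> n \<Longrightarrow> p i \<in> M" and pL: "\<forall>i<n. d (p i) (p (Suc i)) \<le> L"
      and pl: "\<And>i j. i \<le> j \<Longrightarrow> j \<le> n \<Longrightarrow> j - i \<le> l * d (p i) (p j)"
      using qg unfolding quasi_geod_def by auto
    have gX: "\<And>i. i \<le> m \<Longrightarrow> \<gamma> i \<in> M" using geod_between(1)[OF g] m_def by blast
    have gd: "\<And>i j. i \<le> j \<Longrightarrow> j \<le> m \<Longrightarrow> d (\<gamma> i) (\<gamma> j) = j - i"
      and g0: "\<gamma> 0 = p 0" and gm: "\<gamma> m = p n"
      using g unfolding geod_def m_def by auto
    have r_att: "\<exists>j\<le>n. d (\<gamma> i) (p j) = r i" for i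
    proof -
      have "r i \<in> (\<lambda>j. d (\<gamma> i) (p j)) ` {..n}" unfolding r_def by (rule Min_in) auto
      then show ?thesis by auto
    qed
    have r_le: "r i \<le> d (\<gamma> i) (p j)" if "j \<le> n" for i j
      unfolding r_def using that by (intro Min_le) auto
    have D_ge: "r i \<le> D" if "i \<le> m" for i unfolding D_def using that by (intro Max_ge) auto
    have "D \<in> r ` {..m}" unfolding D_def by (rule Max_in) auto
    then obtain i0 where i0: "i0 \<le> m" "r i0 = D" by auto
    let ?q = "\<gamma> i0"
    have q: "?q \<in> M" using gX i0 by blast
    have far: "\<forall>j\<le>n. D \<le> d ?q (p j)" using r_le i0 by blast
    \<comment> \<open>At distance \<open>2 * D\<close> from \<open>?q\<close>, a path point within
      \<open>D\<close> of \<open>\<gamma> a\<close> has product at least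
      \<open>(2 * D + D - D) / 2 = D\<close> with it. Where truncation yields \<open>a = 0\<close>
      or \<open>b = m\<close>, the end of the path itself serves.\<close>
    define a where "a = i0 - 2 * D"
    define b where "b = min m (i0 + 2 * D)"
    have ab: "a \<le> i0" "i0 \<le> b" "b \<le> m" "b - a \<le> 4 * D" unfolding a_def b_def using i0 by auto
    obtain ja where ja: "ja \<le> n" "d (\<gamma> a) (p ja) \<le> D" "real D \<le> gp ?q (\<gamma> a) (p ja)"
    proof (cases "a = 0")
      case True
      have "d (p 0) (p 0) = 0" "real D \<le> d ?q (p 0)" using dist_self pX far by auto
      then show ?thesis using that[of 0] True g0 unfolding gp_def by auto
    next
      case False
      obtain j where j: "j \<le> n" "d (\<gamma> a) (p j) = r a" using r_att by blast
      have "d ?q (\<gamma> a) = 2 * D" using dist_sym[OF q gX[of a]] gd[of a i0] ab i0 False unfolding a_def by auto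
      moreover have "d (\<gamma> a) (p j) \<le> D" using j D_ge[of a] ab i0 by auto
      moreover have "D \<le> d ?q (p j)" using far j by blast
      ultimately show ?thesis using that[of j] j by (auto simp: gp_def field_simps)
    qed
    obtain jb where jb: "jb \<le> n" "d (p jb) (\<gamma> b) \<le> D" "real D \<le> gp ?q (p jb) (\<gamma> b)"
    proof (cases "b = m")
      case True
      have "d (p n) (p n) = 0" "real D \<le> d ?q (p n)" using dist_self pX far by auto
      then show ?thesis using that[of n] True gm unfolding gp_def by auto
    next
      case False
      obtain j where j: "j \<le> n" "d (\<gamma> b) (p j) = r b" using r_att by blast
      have "d ?q (\<gamma> b) = 2 * D" using gd[of i0 b] ab False unfolding b_def by auto
      moreover have "d (p j) (\<gamma> b) \<le> D" using j D_ge[of b] ab dist_sym[OF pX[OF j(1)] gX[of b]] by auto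
      moreover have "D \<le> d ?q (p j)" using far j by blast
      ultimately show ?thesis using that[of j] j by (auto simp: gp_def field_simps)
    qed
    have "d (p ja) (p jb) \<le> d (p ja) (\<gamma> a) + d (\<gamma> a) (p jb)"
      using dist_triangle pX ja jb gX[of a] ab i0 by auto
    also have "\<dots> \<le> d (p ja) (\<gamma> a) + (d (\<gamma> a) (\<gamma> b) + d (\<gamma> b) (p jb))"
      using dist_triangle pX ja jb gX[of a] gX[of b] ab i0 by auto
    also have "\<dots> \<le> D + (4 * D + D)"
      using ja jb ab gd[of a b] dist_sym[of "p ja" "\<gamma> a"] dist_sym[of "\<gamma> b" "p jb"] pX gX[of a] gX[of b] i0
      by auto
    finally have dab: "d (p ja) (p jb) \<le> 6 * D" by simp
    have len: "ja - jb \<le> 6 * l * D" "jb - ja \<le> 6 * l * D"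
    proof -
      have "l * d (p ja) (p jb) \<le> 6 * l * D" using mult_le_mono2[OF dab, of l] by (simp add: algebra_simps)
      moreover have "d (p jb) (p ja) = d (p ja) (p jb)" using dist_sym pX ja jb by blast
      ultimately show "ja - jb \<le> 6 * l * D" "jb - ja \<le> 6 * l * D"
        using pl[of ja jb] pl[of jb ja] ja jb
        by (metis diff_is_0_eq' le_trans nat_le_linear zero_le)+
    qed
    obtain k where k: "6 * l * D \<le> 2 ^ k" "2 ^ k \<le> 12 * l * D + 2"
    proof (cases "6 * l * D = 0")
      case True
      have "6 * l * D \<le> 2 ^ 0" "(2::nat) ^ 0 \<le> 12 * l * D + 2" unfolding True by simp_all
      then show ?thesis by (rule that)
    next
      case False
      obtain k where "2 ^ k \<le> 6 * l * D" "6 * l * D < 2 ^ Suc k"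
        using ex_power_ivl1[of 2 "6 * l * D"] False by auto
      then show ?thesis using that[of "Suc k"] by auto
    qed
    have "real D - real L / 2 - real k * \<delta> \<le> gp ?q (p ja) (p jb)"
      using gp_path_far[OF hyp q, of n p L D ja jb k] pX pL far ja jb len k by auto
    moreover have kd: "0 \<le> real k * \<delta>" using hyp(2) by simp
    ultimately have "real D - real L / 2 - real k * \<delta> - \<delta> \<le> gp ?q (\<gamma> a) (p jb)"
      using four_point_gp[OF hyp(1) q gX[of a] pX[OF jb(1)] pX[OF ja(1)], of "real D - real L / 2 - real k * \<delta>"]
        ja ab i0 by auto
    then have "real D - real L / 2 - real k * \<delta> - \<delta> - \<delta> \<le> gp ?q (\<gamma> a) (\<gamma> b)"
      using four_point_gp[OF hyp(1) q gX[of a] gX[of b] pX[OF jb(1)], of "real D - real L / 2 - real k * \<delta> - \<delta>"]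
        jb ab i0 kd hyp(2) by auto
    moreover have "gp ?q (\<gamma> a) (\<gamma> b) = 0"
      using gd[of a i0] gd[of i0 b] gd[of a b] dist_sym[OF q gX[of a]] ab i0 unfolding gp_def by auto
    ultimately have "real D \<le> (real L / 2 + 2 * \<delta>) + real k * \<delta>" by simp
    moreover have "2 ^ k \<le> real (12 * l) * real D + 2"
    proof -
      have "real (2 ^ k) \<le> real (12 * l * D + 2)" using k(2) by (rule of_nat_mono)
      then show ?thesis by simp
    qed
    ultimately have "D \<le> D0" by (rule D0)
    then show ?thesis using r_att D_ge m_def by (metis le_trans)
  qed
  then show ?thesis by blast
qed

text \<open>A discrete continuity argument: the last geodesic point that is near the path up to
  \<open>j\<close> has a successor that is near the path after \<open>j\<close>. So two path points
  on either side of \<open>j\<close> are at most \<open>2 * D0 + 1\<close> apart, and the lower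
  bound in \<open>quasi_geod\<close> keeps the stretch between them short.\<close>

lemma quasi_geod_near_geod:
  assumes qg: "quasi_geod l L n p" and g: "geod \<gamma> (p 0) (p n)" and j: "j \<le> n"
    and near: "\<forall>i\<le>d (p 0) (p n). \<exists>j\<le>n. d (\<gamma> i) (p j) \<le> D0"
  shows "\<exists>i\<le>d (p 0) (p n). d (p j) (\<gamma> i) \<le> L * (l * (2 * D0 + 1)) + D0"
proof -
  define m where "m = d (p 0) (p n)"
  have pX: "\<And>i. i \<le> n \<Longrightarrow> p i \<in> M" and pL: "\<forall>i<n. d (p i) (p (Suc i)) \<le> L"
    and pl: "\<And>i j. i \<le> j \<Longrightarrow> j \<le> n \<Longrightarrow> j - i \<le> l * d (p i) (p j)"
    using qg unfolding quasi_geod_def by auto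
  have gX: "\<And>i. i \<le> m \<Longrightarrow> \<gamma> i \<in> M" using geod_between(1)[OF g] m_def by blast
  have gd: "\<And>i j. i \<le> j \<Longrightarrow> j \<le> m \<Longrightarrow> d (\<gamma> i) (\<gamma> j) = j - i"
    and g0: "\<gamma> 0 = p 0" and gm: "\<gamma> m = p n"
    using g unfolding geod_def m_def by auto
  define I where "I = {i. i \<le> m \<and> (\<exists>j'\<le>j. d (\<gamma> i) (p j') \<le> D0)}"
  have "0 \<in> I" unfolding I_def using g0 dist_self pX j by (auto intro!: exI[of _ 0])
  have "finite I" by (rule finite_subset[of _ "{..m}"]) (auto simp: I_def)
  define i where "i = Max I"
  have iI: "i \<in> I" unfolding i_def using \<open>finite I\<close> \<open>0 \<in> I\<close> by (intro Max_in) auto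
  have imax: "\<And>i'. i' \<in> I \<Longrightarrow> i' \<le> i" unfolding i_def using \<open>finite I\<close> by auto
  obtain j' where j': "j' \<le> j" "d (\<gamma> i) (p j') \<le> D0" and im: "i \<le> m" using iI I_def by auto
  obtain j'' where j'': "j \<le> j''" "j'' \<le> n" "d (\<gamma> i) (p j'') \<le> D0 + 1"
  proof (cases "i = m")
    case True
    then show ?thesis using that[of n] gm dist_self[OF pX] j by auto
  next
    case False
    then have "Suc i \<le> m" using im by simp
    moreover have "Suc i \<notin> I" using imax by fastforce
    moreover obtain j'' where j'': "j'' \<le> n" "d (\<gamma> (Suc i)) (p j'') \<le> D0"
      using near \<open>Suc i \<le> m\<close> unfolding m_def by blast
    ultimately have "\<not> j'' \<le> j" unfolding I_def by blast
    then have "j \<le> j''" by simp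
    have "d (\<gamma> i) (p j'') \<le> d (\<gamma> i) (\<gamma> (Suc i)) + d (\<gamma> (Suc i)) (p j'')"
      using dist_triangle gX im pX j'' \<open>Suc i \<le> m\<close> by blast
    then have "d (\<gamma> i) (p j'') \<le> D0 + 1" using gd[of i "Suc i"] \<open>Suc i \<le> m\<close> j'' by simp
    then show ?thesis using that \<open>j \<le> j''\<close> j'' by blast
  qed
  have M: "p j \<in> M" "p j' \<in> M" "p j'' \<in> M" "\<gamma> i \<in> M" using pX gX im j j' j'' by auto
  have "d (p j') (p j'') \<le> 2 * D0 + 1"
    using dist_triangle[OF M(2,4,3)] dist_sym[OF M(2,4)] j' j'' by simp
  then have "j - j' \<le> l * (2 * D0 + 1)"
    using pl[of j' j''] j' j'' by (meson diff_le_mono dual_order.trans le_trans mult_le_mono2)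
  then have "d (p j') (p j) \<le> L * (l * (2 * D0 + 1))"
    using path_dist_le[of n p L j' j] pX pL j j' by (meson le_trans mult_le_mono2)
  then have "d (p j) (\<gamma> i) \<le> L * (l * (2 * D0 + 1)) + D0"
    using dist_triangle[OF M(1,2,4)] dist_sym[OF M(1,2)] dist_sym[OF M(2,4)] j' by simp
  then show ?thesis using im m_def by blast
qed

text \<open>The point to compare with \<open>q\<close> is the one on the side at the same distance
  from \<open>x\<close>. If the side is too short for that, \<open>q\<close> is within
  \<open>2 * \<delta>\<close> of \<open>z\<close>.\<close>

lemma near_side:
  assumes hyp: "four_point M d \<delta>" "0 \<le> \<delta>" and M: "x \<in> M" "z \<in> M" "q \<in> M"
    and g: "geod \<gamma> x z" and q: "gp q x z \<le> \<delta>"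
  shows "\<exists>i\<le>d x z. real (d q (\<gamma> i)) \<le> 4 * \<delta>"
proof (cases "d x q \<le> d x z")
  case True
  let ?u = "\<gamma> (d x q)"
  note u = geod_between[OF g True]
  have "real (d q ?u) + real (d x z) \<le> max (real (d x ?u) + real (d q z)) (real (d x q) + real (d z ?u)) + 2 * \<delta>"
    by (rule four_pointD[OF hyp(1)]) (use M u in auto)
  moreover have "real (d q x) + real (d q z) - real (d x z) \<le> 2 * \<delta>" using q unfolding gp_def by simp
  moreover have "d z ?u = d x z - d x q" "d q x = d x q" using dist_sym M u by metis+
  ultimately have "real (d q ?u) \<le> 4 * \<delta>" using u True hyp(2) by (auto simp: max_def split: if_splits)
  then show ?thesis using True by blast
next
  case False
  have "real (d q x) + real (d q z) - real (d x z) \<le> 2 * \<delta>" using q unfolding gp_def by simp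
  moreover have "d q x = d x q" using dist_sym M by metis
  ultimately have "real (d q (\<gamma> (d x z))) \<le> 4 * \<delta>" using False g unfolding geod_def by auto
  then show ?thesis by blast
qed

section \<open>Thin triangles and the four-point condition\<close>

definition thin :: "nat \<Rightarrow> bool" where
  "thin e \<longleftrightarrow> (\<forall>x\<in>M. \<forall>y\<in>M. \<forall>z\<in>M. \<forall>a b c. geod a x y \<longrightarrow> geod b x z \<longrightarrow> geod c z y \<longrightarrow>
     (\<forall>i\<le>d x y. (\<exists>j\<le>d x z. d (a i) (b j) \<le> e) \<or> (\<exists>j\<le>d z y. d (a i) (c j) \<le> e)))"

lemma gp_le_dist_side:
  assumes "x \<in> M" "y \<in> M" "w \<in> M" "geod a x y" "i \<le> d x y"
  shows "gp w x y \<le> real (d w (a i))"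
proof -
  note u = geod_between[OF assms(4,5)]
  have "d w x \<le> d w (a i) + d (a i) x" "d w y \<le> d w (a i) + d (a i) y"
    using dist_triangle assms u by blast+
  moreover have "d (a i) x = d x (a i)" using dist_sym assms u by blast
  ultimately show ?thesis using u assms(5) unfolding gp_def by auto
qed

text \<open>Together with \<open>gp_le_dist_side\<close>: in a thin space the Gromov product is the
  distance from \<open>w\<close> to the side, up to a constant. The last point of the side that is
  near the geodesic \<open>b\<close> has a successor near \<open>c\<close>, so it is close to both,
  and the side lengths then determine its distance to \<open>w\<close>.\<close>

lemma dist_side_le_gp:
  assumes th: "thin e" and M: "x \<in> M" "y \<in> M" "w \<in> M" and a: "geod a x y"
  shows "\<exists>i\<le>d x y. real (d w (a i)) \<le> gp w x y + 2 * real e + 1"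
proof -
  obtain b where b: "geod b x w" using geod_exists[OF M(1,3)] by blast
  obtain c where c: "geod c w y" using geod_exists[OF M(3,2)] by blast
  define m where "m = d x y"
  have aX: "\<And>i. i \<le> m \<Longrightarrow> a i \<in> M" using geod_between(1)[OF a] m_def by blast
  have near: "(\<exists>j\<le>d x w. d (a i) (b j) \<le> e) \<or> (\<exists>j\<le>d w y. d (a i) (c j) \<le> e)" if "i \<le> m" for i
    using th M a b c that unfolding thin_def m_def by blast
  define I where "I = {i. i \<le> m \<and> (\<exists>j\<le>d x w. d (a i) (b j) \<le> e)}"
  have "0 \<in> I" unfolding I_def using a b dist_self M by (auto simp: geod_def intro!: exI[of _ 0])
  have "finite I" by (rule finite_subset[of _ "{..m}"]) (auto simp: I_def)
  define i where "i = Max I"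
  have iI: "i \<in> I" unfolding i_def using \<open>finite I\<close> \<open>0 \<in> I\<close> by (intro Max_in) auto
  have imax: "\<And>i'. i' \<in> I \<Longrightarrow> i' \<le> i" unfolding i_def using \<open>finite I\<close> by auto
  obtain j where j: "j \<le> d x w" "d (a i) (b j) \<le> e" and im: "i \<le> m" using iI I_def by auto
  obtain k where k: "k \<le> d w y" "d (a i) (c k) \<le> e + 1"
  proof (cases "i = m")
    case True
    have "a i = y" "c (d w y) = y" using True a c m_def unfolding geod_def by auto
    then show ?thesis using that[of "d w y"] dist_self M by auto
  next
    case False
    then have Si: "Suc i \<le> m" using im by simp
    moreover have "Suc i \<notin> I" using imax by fastforce
    ultimately have "\<not> (\<exists>j\<le>d x w. d (a (Suc i)) (b j) \<le> e)" unfolding I_def by auto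
    then obtain k where k: "k \<le> d w y" "d (a (Suc i)) (c k) \<le> e" using near[OF Si] by blast
    have "d (a i) (c k) \<le> d (a i) (a (Suc i)) + d (a (Suc i)) (c k)"
      using dist_triangle aX im Si geod_between(1)[OF c k(1)] by blast
    moreover have "d (a i) (a (Suc i)) = 1" using a Si unfolding geod_def m_def by auto
    ultimately show ?thesis using that[of k] k by simp
  qed
  note u = geod_between[OF b j(1)] and v = geod_between[OF c k(1)] and p = geod_between[OF a im[unfolded m_def]]
  have "d x (b j) \<le> d x (a i) + d (a i) (b j)" "d (c k) y \<le> d (c k) (a i) + d (a i) y"
    "d w (a i) \<le> d w (b j) + d (b j) (a i)" "d w (a i) \<le> d w (c k) + d (c k) (a i)"
    "d x (a i) \<le> d x (b j) + d (b j) (a i)" "d (a i) y \<le> d (a i) (c k) + d (c k) y"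
    using dist_triangle M u v p by blast+
  moreover have "d (b j) (a i) = d (a i) (b j)" "d (c k) (a i) = d (a i) (c k)" "d w (b j) = d (b j) w" "d w x = d x w"
    using dist_sym M u v p by blast+
  moreover have "d x (b j) + d (b j) w = d x w" "d w (c k) + d (c k) y = d w y" "d x (a i) + d (a i) y = d x y"
    using u v p j k im[unfolded m_def] by simp_all
  ultimately have "2 * d w (a i) + d x y \<le> d w x + d w y + 4 * e + 2"
    using j(2) k(2) by linarith
  then have "real (2 * d w (a i) + d x y) \<le> real (d w x + d w y + 4 * e + 2)" by (rule of_nat_mono)
  then have "real (d w (a i)) \<le> gp w x y + 2 * real e + 1"
    unfolding gp_def by (simp add: field_simps)
  then show ?thesis using im m_def by blast
qed

text \<open>A point of one side that nearly realizes the product \<open>gp w x y\<close> is within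
  \<open>e\<close> of another side, and its distance to \<open>w\<close> bounds the product of that
  side. The constant is \<open>2 * e + 1\<close> from \<open>dist_side_le_gp\<close> plus
  \<open>e\<close> from thinness.\<close>

lemma thin_imp_four_point:
  assumes th: "thin e"
  shows "four_point M d (3 * real e + 1)"
  unfolding four_point_def
proof (intro ballI)
  fix w x y z assume M: "w \<in> M" "x \<in> M" "y \<in> M" "z \<in> M"
  obtain a where g1: "geod a x y" using geod_exists[OF M(2,3)] by blast
  obtain b where g2: "geod b x z" using geod_exists[OF M(2,4)] by blast
  obtain c where g3: "geod c z y" using geod_exists[OF M(4,3)] by blast
  note g = g1 g2 g3
  obtain i where i: "i \<le> d x y" "real (d w (a i)) \<le> gp w x y + 2 * real e + 1"
    using dist_side_le_gp[OF th M(2,3,1) g(1)] by blast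
  note p = geod_between(1)[OF g(1) i(1)]
  have "min (gp w x z) (gp w z y) \<le> real (d w (a i)) + real e"
  proof -
    consider (1) j where "j \<le> d x z" "d (a i) (b j) \<le> e" | (2) j where "j \<le> d z y" "d (a i) (c j) \<le> e"
      using th M g i(1) unfolding thin_def by blast
    then show ?thesis
    proof cases
      case 1
      have "gp w x z \<le> real (d w (b j))" using gp_le_dist_side M g(2) 1(1) by blast
      moreover have "d w (b j) \<le> d w (a i) + d (a i) (b j)"
        using dist_triangle M p geod_between(1)[OF g(2) 1(1)] by blast
      ultimately show ?thesis using 1(2) by linarith
    next
      case 2
      have "gp w z y \<le> real (d w (c j))" using gp_le_dist_side M g(3) 2(1) by blast
      moreover have "d w (c j) \<le> d w (a i) + d (a i) (c j)"
        using dist_triangle M p geod_between(1)[OF g(3) 2(1)] by blast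
      ultimately show ?thesis using 2(2) by linarith
    qed
  qed
  then have "min (gp w x z) (gp w z y) \<le> gp w x y + 3 * real e + 1" using i(2) by linarith
  then show "real (d x y) + real (d w z) \<le> max (real (d w y) + real (d x z)) (real (d w x) + real (d z y)) + 2 * (3 * real e + 1)"
    unfolding gp_def by (auto simp: min_def max_def field_simps split: if_splits)
qed

end

text \<open>A multiplicative distortion would ruin the additive four-point inequality, but thinness
  survives it. A geodesic triangle of \<open>Y\<close> has quasi-geodesic sides in \<open>M\<close>;
  these lie near geodesics, where the four-point condition applies, and the lower bound
  \<open>lo\<close> carries the resulting closeness back to \<open>Y\<close>.\<close>

theorem four_point_bilipschitz:
  assumes "graph_metric M d" "graph_metric Y e"
    and hyp: "four_point M d \<delta>"
    and f: "\<And>y. y \<in> Y \<Longrightarrow> f y \<in> M"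
    and up: "\<And>x y. x \<in> Y \<Longrightarrow> y \<in> Y \<Longrightarrow> d (f x) (f y) \<le> L * e x y"
    and lo: "\<And>x y. x \<in> Y \<Longrightarrow> y \<in> Y \<Longrightarrow> e x y \<le> l * d (f x) (f y)"
  shows "\<exists>\<delta>'. four_point Y e \<delta>'"
proof -
  interpret M: graph_metric M d by fact
  interpret Y: graph_metric Y e by fact
  define \<delta>1 where "\<delta>1 = max \<delta> 0"
  have hyp1: "four_point M d \<delta>1" "0 \<le> \<delta>1"
    using four_point_mono[OF hyp] by (auto simp: \<delta>1_def)
  obtain D0 where D0: "\<And>n p \<gamma> i. M.quasi_geod l L n p \<Longrightarrow> M.geod \<gamma> (p 0) (p n) \<Longrightarrow> i \<le> d (p 0) (p n)
     \<Longrightarrow> \<exists>j\<le>n. d (\<gamma> i) (p j) \<le> D0"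
    using M.geod_near_quasi_geod[OF hyp1, of l L] by blast
  have qg: "M.quasi_geod l L (e x y) (\<lambda>i. f (a i))" if "Y.geod a x y" "x \<in> Y" "y \<in> Y" for a x y
    unfolding M.quasi_geod_def
  proof (intro conjI allI impI)
    fix i assume "i \<le> e x y" then show "f (a i) \<in> M" using Y.geod_between(1) that f by blast
  next
    fix i assume "i < e x y"
    then have "a i \<in> Y" "a (Suc i) \<in> Y" "e (a i) (a (Suc i)) = 1" using that unfolding Y.geod_def by auto
    then show "d (f (a i)) (f (a (Suc i))) \<le> L" using up by fastforce
  next
    fix i j assume "i \<le> j" "j \<le> e x y"
    then have "a i \<in> Y" "a j \<in> Y" "e (a i) (a j) = j - i" using that unfolding Y.geod_def by auto
    then show "j - i \<le> l * d (f (a i)) (f (a j))" using lo by metis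
  qed
  define D1 where "D1 = L * (l * (2 * D0 + 1)) + D0"
  \<comment> \<open>The way from a point of one image side to another image side: \<open>D1\<close>
    to the geodesic, \<open>4 * \<delta>1\<close> across to another geodesic, \<open>D0\<close> to
    the image path; \<open>l\<close> converts back to \<open>Y\<close>.\<close>
  define E where "E = l * (D1 + nat \<lceil>4 * \<delta>1\<rceil> + D0)"
  have "Y.thin E"
    unfolding Y.thin_def
  proof (intro ballI allI impI)
    fix x y z a b c i
    assume Y: "x \<in> Y" "y \<in> Y" "z \<in> Y" and g: "Y.geod a x y" "Y.geod b x z" "Y.geod c z y" and i: "i \<le> e x y"
    note ends = g[unfolded Y.geod_def]
    obtain \<gamma> where \<gamma>: "M.geod \<gamma> (f x) (f y)" using M.geod_exists f Y by blast
    obtain \<beta> where \<beta>: "M.geod \<beta> (f x) (f z)" using M.geod_exists f Y by blast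
    obtain \<eta> where \<eta>: "M.geod \<eta> (f z) (f y)" using M.geod_exists f Y by blast
    have "\<exists>i'\<le>d (f x) (f y). d (f (a i)) (\<gamma> i') \<le> D1"
      using M.quasi_geod_near_geod[OF qg[OF g(1) Y(1,2)], of \<gamma> i D0] D0[OF qg[OF g(1) Y(1,2)], of \<gamma>]
        \<gamma> ends i unfolding D1_def by auto
    then obtain i' where i': "i' \<le> d (f x) (f y)" "d (f (a i)) (\<gamma> i') \<le> D1" by blast
    let ?q = "\<gamma> i'"
    note q = M.geod_between[OF \<gamma> i'(1)]
    have aY: "a i \<in> Y" using Y.geod_between(1)[OF g(1) i] .
    have fin: "e (a i) v \<le> E" if "v \<in> Y" "u \<in> M" "real (d ?q u) \<le> 4 * \<delta>1" "d u (f v) \<le> D0" for u v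
    proof -
      have "d (f (a i)) (f v) \<le> d (f (a i)) ?q + d ?q (f v)" "d ?q (f v) \<le> d ?q u + d u (f v)"
        using M.dist_triangle f aY q(1) that by blast+
      moreover have "d ?q u \<le> nat \<lceil>4 * \<delta>1\<rceil>" using that by linarith
      ultimately have "d (f (a i)) (f v) \<le> D1 + nat \<lceil>4 * \<delta>1\<rceil> + D0" using that i' by linarith
      then show ?thesis unfolding E_def using lo[OF aY that(1)] by (meson le_trans mult_le_mono2)
    qed
    \<comment> \<open>As the product of \<open>f x\<close> and \<open>f y\<close> at
      \<open>?q\<close> vanishes, the four-point condition makes one of the other two products at
      most \<open>\<delta>1\<close>, which puts \<open>?q\<close> near that side.\<close>
    have "M.gp ?q (f x) (f y) = 0"
      using q i'(1) M.dist_sym[of "f x" ?q] f Y by (simp add: M.gp_def)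
    then have "M.gp ?q (f x) (f z) \<le> \<delta>1 \<or> M.gp ?q (f z) (f y) \<le> \<delta>1"
      using M.four_point_gp[OF hyp1(1) q(1) f[OF Y(1)] f[OF Y(2)] f[OF Y(3)],
          of "min (M.gp ?q (f x) (f z)) (M.gp ?q (f z) (f y))"] by linarith
    then show "(\<exists>j\<le>e x z. e (a i) (b j) \<le> E) \<or> (\<exists>j\<le>e z y. e (a i) (c j) \<le> E)"
    proof
      assume "M.gp ?q (f x) (f z) \<le> \<delta>1"
      then obtain k where k: "k \<le> d (f x) (f z)" "real (d ?q (\<beta> k)) \<le> 4 * \<delta>1"
        using M.near_side[OF hyp1 f[OF Y(1)] f[OF Y(3)] q(1) \<beta>] by blast
      obtain j where j: "j \<le> e x z" "d (\<beta> k) (f (b j)) \<le> D0"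
        using D0[OF qg[OF g(2) Y(1,3)], of \<beta> k] \<beta> k ends by auto
      then show ?thesis
        using fin[of "b j" "\<beta> k"] Y.geod_between(1)[OF g(2) j(1)] M.geod_between(1)[OF \<beta> k(1)] k by blast
    next
      assume "M.gp ?q (f z) (f y) \<le> \<delta>1"
      then obtain k where k: "k \<le> d (f z) (f y)" "real (d ?q (\<eta> k)) \<le> 4 * \<delta>1"
        using M.near_side[OF hyp1 f[OF Y(3)] f[OF Y(2)] q(1) \<eta>] by blast
      obtain j where j: "j \<le> e z y" "d (\<eta> k) (f (c j)) \<le> D0"
        using D0[OF qg[OF g(3) Y(3,2)], of \<eta> k] \<eta> k ends by auto
      then show ?thesis
        using fin[of "c j" "\<eta> k"] Y.geod_between(1)[OF g(3) j(1)] M.geod_between(1)[OF \<eta> k(1)] k by blast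
    qed
  qed
  then show ?thesis using Y.thin_imp_four_point by blast
qed

section \<open>Word metrics\<close>

definition word_ball :: "('g, 'b) monoid_scheme \<Rightarrow> 'g set \<Rightarrow> nat \<Rightarrow> 'g set" where
  "word_ball G S n = {foldr (\<otimes>\<^bsub>G\<^esub>) ws \<one>\<^bsub>G\<^esub> | ws. length ws \<le> n \<and> set ws \<subseteq> S \<union> m_inv G ` S}"

context group
begin

lemma symmetric_closed: "S \<subseteq> carrier G \<Longrightarrow> S \<union> m_inv G ` S \<subseteq> carrier G"
  by auto

lemma foldr_mult_closed: "set ws \<subseteq> carrier G \<Longrightarrow> foldr (\<otimes>) ws \<one> \<in> carrier G"
  by (induction ws) auto

lemma foldr_mult_append:
  "set us \<subseteq> carrier G \<Longrightarrow> set vs \<subseteq> carrier G \<Longrightarrow>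
    foldr (\<otimes>) (us @ vs) \<one> = foldr (\<otimes>) us \<one> \<otimes> foldr (\<otimes>) vs \<one>"
  by (induction us) (auto simp: m_assoc foldr_mult_closed simp del: foldr_append)

lemma word_ball_carrier:
  assumes "S \<subseteq> carrier G" shows "word_ball G S n \<subseteq> carrier G"
proof
  fix g assume "g \<in> word_ball G S n"
  then obtain ws where "g = foldr (\<otimes>) ws \<one>" "set ws \<subseteq> S \<union> m_inv G ` S"
    unfolding word_ball_def by auto
  then show "g \<in> carrier G" using foldr_mult_closed order.trans symmetric_closed[OF assms] by metis
qed

lemma word_ball_one: "\<one> \<in> word_ball G S n"
  unfolding word_ball_def by (auto intro!: exI[of _ "[]"])

lemma word_ball_mono: "m \<le> n \<Longrightarrow> word_ball G S m \<subseteq> word_ball G S n"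
  unfolding word_ball_def by fastforce

lemma word_ball_gen:
  assumes "S \<subseteq> carrier G" "s \<in> S \<union> m_inv G ` S"
  shows "s \<in> word_ball G S (Suc n)"
proof -
  have "s \<in> carrier G" using assms symmetric_closed by blast
  then show ?thesis unfolding word_ball_def using assms by (auto intro!: exI[of _ "[s]"])
qed

lemma word_ball_mult:
  assumes S: "S \<subseteq> carrier G" and "a \<in> word_ball G S m" "b \<in> word_ball G S n"
  shows "a \<otimes> b \<in> word_ball G S (m + n)"
proof -
  obtain us where us: "a = foldr (\<otimes>) us \<one>" "length us \<le> m" "set us \<subseteq> S \<union> m_inv G ` S"
    using assms(2) unfolding word_ball_def by blast
  obtain vs where vs: "b = foldr (\<otimes>) vs \<one>" "length vs \<le> n" "set vs \<subseteq> S \<union> m_inv G ` S"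
    using assms(3) unfolding word_ball_def by blast
  have "a \<otimes> b = foldr (\<otimes>) (us @ vs) \<one>"
    using foldr_mult_append us vs symmetric_closed[OF S] by (metis order.trans)
  then show ?thesis unfolding word_ball_def using us vs
    by (intro CollectI exI[of _ "us @ vs"]) auto
qed

lemma word_ball_inv:
  assumes S: "S \<subseteq> carrier G" and "a \<in> word_ball G S m"
  shows "inv a \<in> word_ball G S m"
proof -
  have "inv (foldr (\<otimes>) us \<one>) \<in> word_ball G S (length us)" if "set us \<subseteq> S \<union> m_inv G ` S" for us
    using that
  proof (induction us)
    case Nil
    then show ?case using word_ball_one by simp
  next
    case (Cons u us)
    have u: "u \<in> carrier G" "foldr (\<otimes>) us \<one> \<in> carrier G"
      using Cons.prems symmetric_closed[OF S] foldr_mult_closed[of us] by auto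
    have "inv u \<in> S \<union> m_inv G ` S" using Cons.prems S by (auto simp: subset_iff)
    then have "inv u \<in> word_ball G S 1" using word_ball_gen[OF S, of "inv u" 0] by simp
    moreover have "inv (foldr (\<otimes>) us \<one>) \<in> word_ball G S (length us)" using Cons by simp
    ultimately have "inv (foldr (\<otimes>) us \<one>) \<otimes> inv u \<in> word_ball G S (length us + 1)"
      by (rule word_ball_mult[OF S, rotated])
    then show ?case using u by (simp add: inv_mult_group)
  qed
  moreover obtain us where "a = foldr (\<otimes>) us \<one>" "length us \<le> m" "set us \<subseteq> S \<union> m_inv G ` S"
    using assms(2) unfolding word_ball_def by auto
  ultimately show ?thesis using word_ball_mono by blast
qed

lemma word_ball_finite:
  assumes "finite S" shows "finite (word_ball G S n)"
proof -
  have "finite {ws. set ws \<subseteq> S \<union> m_inv G ` S \<and> length ws \<le> n}"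
    using assms by (intro finite_lists_length_le) auto
  moreover have "word_ball G S n = (\<lambda>ws. foldr (\<otimes>) ws \<one>) ` {ws. set ws \<subseteq> S \<union> m_inv G ` S \<and> length ws \<le> n}"
    unfolding word_ball_def by auto
  ultimately show ?thesis by simp
qed

lemma word_ball_split:
  assumes S: "S \<subseteq> carrier G" and "g \<in> word_ball G S (m + n)"
  shows "\<exists>a\<in>word_ball G S m. \<exists>b\<in>word_ball G S n. g = a \<otimes> b"
proof -
  obtain ws where ws: "g = foldr (\<otimes>) ws \<one>" "length ws \<le> m + n" "set ws \<subseteq> S \<union> m_inv G ` S"
    using assms(2) unfolding word_ball_def by blast
  have sub: "set (take m ws) \<subseteq> S \<union> m_inv G ` S" "set (drop m ws) \<subseteq> S \<union> m_inv G ` S"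
    using ws(3) set_take_subset[of m ws] set_drop_subset[of m ws] by blast+
  have "g = foldr (\<otimes>) (take m ws) \<one> \<otimes> foldr (\<otimes>) (drop m ws) \<one>"
    using ws(1) foldr_mult_append[of "take m ws" "drop m ws"] sub symmetric_closed[OF S]
    by (metis append_take_drop_id order.trans)
  moreover have "foldr (\<otimes>) (take m ws) \<one> \<in> word_ball G S m"
    unfolding word_ball_def using sub(1) by (intro CollectI exI[of _ "take m ws"]) auto
  moreover have "foldr (\<otimes>) (drop m ws) \<one> \<in> word_ball G S n"
    unfolding word_ball_def using sub(2) ws(2) by (intro CollectI exI[of _ "drop m ws"]) auto
  ultimately show ?thesis by blast
qed

lemma generate_eq_word_balls:
  assumes S: "S \<subseteq> carrier G"
  shows "generate G S = (\<Union>n. word_ball G S n)"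
proof (intro equalityI subsetI)
  fix g assume "g \<in> generate G S"
  then show "g \<in> (\<Union>n. word_ball G S n)"
  proof (induction rule: generate.induct)
    case one
    then show ?case using word_ball_one by blast
  next
    case (incl h)
    then show ?case using word_ball_gen[OF S, of h 0] by blast
  next
    case (inv h)
    then show ?case using word_ball_gen[OF S, of "inv h" 0] by blast
  next
    case (eng h1 h2)
    then show ?case using word_ball_mult[OF S] by blast
  qed
next
  fix g assume "g \<in> (\<Union>n. word_ball G S n)"
  then obtain ws where "g = foldr (\<otimes>) ws \<one>" "set ws \<subseteq> S \<union> m_inv G ` S"
    unfolding word_ball_def by blast
  then show "g \<in> generate G S"
    by (induction ws arbitrary: g) (auto intro: generate.intros)
qed

end

lemma (in group) int_pow_commute:
  assumes "c \<in> carrier G" "z \<in> carrier G" "c \<otimes> z = z \<otimes> c"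
  shows "c \<otimes> z [^] (i::int) = z [^] i \<otimes> c"
proof -
  have nat: "c \<otimes> z [^] (n::nat) = z [^] n \<otimes> c" for n
    using group_commutes_pow[of z c n] assms by simp
  have neg: "c \<otimes> inv w = inv w \<otimes> c" if "c \<otimes> w = w \<otimes> c" "w \<in> carrier G" for w
  proof -
    have "w \<otimes> (c \<otimes> inv w) = (c \<otimes> w) \<otimes> inv w" using that assms(1) by (simp add: m_assoc[symmetric])
    also have "\<dots> = c" using that(2) assms(1) by (simp add: m_assoc)
    finally show ?thesis using that(2) assms(1) by (simp add: inv_solve_left)
  qed
  show ?thesis
    unfolding int_pow_def2 using nat neg[OF nat nat_pow_closed[OF assms(2)]] by (cases "i < 0") (simp_all only: if_True if_False)
qed

locale word_metric = group G for G :: "('g, 'b) monoid_scheme" (structure) +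
  fixes S :: "'g set"
  assumes fin: "finite S" and sub: "S \<subseteq> carrier G" and gen: "generate G S = carrier G"
begin

abbreviation "wl \<equiv> word_length G S"
abbreviation "wd \<equiv> word_dist G S"

text \<open>Generation is what makes the \<open>LEAST\<close> in \<open>word_length\<close> range
  over a nonempty set. From here on lengths are handled through membership in balls.\<close>

lemma wl_le_iff:
  assumes "g \<in> carrier G" shows "wl g \<le> n \<longleftrightarrow> g \<in> word_ball G S n"
proof -
  define P where "P n \<longleftrightarrow> (\<exists>ws. length ws = n \<and> set ws \<subseteq> S \<union> m_inv G ` S \<and> foldr (\<otimes>) ws \<one> = g)" for n
  have wl: "wl g = (LEAST n. P n)" unfolding word_length_def P_def ..
  have ball: "g \<in> word_ball G S n \<longleftrightarrow> (\<exists>m\<le>n. P m)" for n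
    unfolding word_ball_def P_def by blast
  have "\<exists>n. P n" using assms generate_eq_word_balls[OF sub] gen ball by blast
  then have "P (wl g)" unfolding wl by (rule LeastI_ex)
  moreover have "P m \<Longrightarrow> wl g \<le> m" for m unfolding wl by (rule Least_le)
  ultimately show ?thesis using ball le_trans by blast
qed

lemma wl_ball: "g \<in> carrier G \<Longrightarrow> g \<in> word_ball G S (wl g)"
  using wl_le_iff by blast

lemma wl_one: "wl \<one> = 0"
  using wl_le_iff[of \<one> 0] word_ball_one by simp

lemma wl_eq_0: "g \<in> carrier G \<Longrightarrow> wl g = 0 \<Longrightarrow> g = \<one>"
  using wl_le_iff[of g 0] unfolding word_ball_def by auto

lemma wl_mult: "a \<in> carrier G \<Longrightarrow> b \<in> carrier G \<Longrightarrow> wl (a \<otimes> b) \<le> wl a + wl b"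
  using wl_le_iff word_ball_mult[OF sub] wl_ball by simp

lemma wl_inv: "a \<in> carrier G \<Longrightarrow> wl (inv a) = wl a"
  using wl_le_iff word_ball_inv[OF sub] wl_ball by (metis inv_closed inv_inv le_antisym)

lemma wl_pow: "a \<in> carrier G \<Longrightarrow> wl (a [^] (n::nat)) \<le> n * wl a"
proof (induction n)
  case (Suc n)
  then show ?case using wl_mult[of "a [^] n" a] by simp
qed (simp add: wl_one)

lemma wl_split:
  assumes "g \<in> carrier G" "wl g = m + n"
  shows "\<exists>a\<in>carrier G. wl a = m \<and> wl (inv a \<otimes> g) = n"
proof -
  obtain a b where ab: "a \<in> word_ball G S m" "b \<in> word_ball G S n" "g = a \<otimes> b"
    using word_ball_split[OF sub] wl_ball[OF assms(1)] assms(2) by metis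
  then have c: "a \<in> carrier G" "b \<in> carrier G" using word_ball_carrier[OF sub] by blast+
  then have "wl a \<le> m" "wl b \<le> n" using wl_le_iff ab by blast+
  moreover have "inv a \<otimes> g = b" using ab c by (simp add: m_assoc[symmetric])
  moreover have "m + n \<le> wl a + wl b" using wl_mult[OF c] ab assms by simp
  ultimately show ?thesis using c by (intro bexI[of _ a]) auto
qed

lemma wd_left: "a \<in> carrier G \<Longrightarrow> x \<in> carrier G \<Longrightarrow> y \<in> carrier G \<Longrightarrow> wd (a \<otimes> x) (a \<otimes> y) = wd x y"
  unfolding word_dist_def by (simp add: inv_mult_group m_assoc) (simp add: m_assoc[symmetric])

lemma wd_one: "x \<in> carrier G \<Longrightarrow> wd \<one> x = wl x"
  unfolding word_dist_def by simp

sublocale graph_metric "carrier G" wd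
proof
  show "wd x x = 0" if "x \<in> carrier G" for x
    using that wl_one by (simp add: word_dist_def)
  show sym: "wd x y = wd y x" if "x \<in> carrier G" "y \<in> carrier G" for x y
    using that wl_inv[of "inv x \<otimes> y"] by (simp add: word_dist_def inv_mult_group)
  show "wd x z \<le> wd x y + wd y z" if "x \<in> carrier G" "y \<in> carrier G" "z \<in> carrier G" for x y z
  proof -
    have "(inv x \<otimes> y) \<otimes> (inv y \<otimes> z) = inv x \<otimes> z"
      using that by (simp add: m_assoc) (simp add: m_assoc[symmetric])
    then show ?thesis using wl_mult[of "inv x \<otimes> y" "inv y \<otimes> z"] that unfolding word_dist_def by simp
  qed
  show "x = y" if "x \<in> carrier G" "y \<in> carrier G" "wd x y = 0" for x y
    using that wl_eq_0[of "inv x \<otimes> y"] unfolding word_dist_def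
    by (metis inv_closed inv_equality inv_inv m_closed)
  show "\<exists>z\<in>carrier G. wd x z = 1 \<and> wd z y = n" if "x \<in> carrier G" "y \<in> carrier G" "wd x y = Suc n" for x y n
  proof -
    have "inv x \<otimes> y \<in> carrier G" "wl (inv x \<otimes> y) = 1 + n" using that unfolding word_dist_def by auto
    then obtain a where a: "a \<in> carrier G" "wl a = 1" "wl (inv a \<otimes> (inv x \<otimes> y)) = n"
      using wl_split by blast
    have "inv x \<otimes> (x \<otimes> a) = a" using a that by (simp add: m_assoc[symmetric])
    moreover have "inv (x \<otimes> a) \<otimes> y = inv a \<otimes> (inv x \<otimes> y)" using a that by (simp add: m_assoc inv_mult_group)
    ultimately show ?thesis using a that unfolding word_dist_def by (intro bexI[of _ "x \<otimes> a"]) auto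
  qed
qed

text \<open>Multiplying the inequality of Gromov products by 2 and cancelling the common distances
  turns the minimum into a maximum of sums, one for each way of pairing the four points.\<close>

lemma four_point_iff:
  "four_point (carrier G) wd \<delta> \<longleftrightarrow> (\<forall>w\<in>carrier G. \<forall>x\<in>carrier G. \<forall>y\<in>carrier G. \<forall>z\<in>carrier G.
     gromov_product G S w x y \<ge> min (gromov_product G S w x z) (gromov_product G S w z y) - \<delta>)"
proof -
  have "(real (wd x y) + real (wd w z) \<le> max (real (wd w y) + real (wd x z)) (real (wd w x) + real (wd z y)) + 2 * \<delta>)
    \<longleftrightarrow> gromov_product G S w x y \<ge> min (gromov_product G S w x z) (gromov_product G S w z y) - \<delta>" for w x y z
    unfolding gromov_product_def by (auto simp: min_def max_def field_simps)
  then show ?thesis unfolding four_point_def by simp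
qed

text \<open>If \<open>z\<close> moves both ends of a long geodesic from \<open>\<one>\<close> to \<open>g\<close> by
  little, it moves the midpoint \<open>h\<close> by at most \<open>6\<delta>\<close>; since \<open>g\<close> centralizes \<open>z\<close>
  and is shortest in its coset of \<open>\<langle>z\<rangle>\<close>, this applies to many powers of \<open>z\<close> at once.\<close>

lemma midpoint_conjugate:
  assumes hyp: "four_point (carrier G) wd \<delta>" "0 \<le> \<delta>"
    and c: "g \<in> carrier G" "y \<in> carrier G" "h \<in> carrier G" and comm: "g \<otimes> y = y \<otimes> g"
    and min: "wl g \<le> wl (g \<otimes> y)" "wl g \<le> wl (inv y \<otimes> g)"
    and y: "2 * wl y \<le> wl g"
    and h: "wl h = s" "wl (inv h \<otimes> g) = wl g - s" and s: "wl g \<le> 4 * s" "2 * s \<le> wl g"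
  shows "real (wl (inv h \<otimes> y \<otimes> h)) \<le> 6 * \<delta>"
proof -
  let ?d = "real (wl g)"
  note fp = four_pointD[OF hyp(1)]
  have M: "\<one> \<in> carrier G" "y \<in> carrier G" "g \<in> carrier G" "y \<otimes> g \<in> carrier G" "h \<in> carrier G" "y \<otimes> h \<in> carrier G"
    using c by auto
  have e: "wd \<one> y = wl y" "wd y \<one> = wl y" "wd \<one> g = wl g" "wd g \<one> = wl g" "wd \<one> h = s" "wd h \<one> = s"
    "wd h g = wl g - s" "wd g h = wl g - s"
    using wd_one dist_sym M h wl_inv by (auto simp: word_dist_def)
  have e2: "wd y (y \<otimes> g) = wl g" "wd (y \<otimes> g) y = wl g" "wd y (y \<otimes> h) = s" "wd (y \<otimes> h) y = s"
    "wd (y \<otimes> h) (y \<otimes> g) = wl g - s" "wd (y \<otimes> g) (y \<otimes> h) = wl g - s"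
    using wd_left[OF c(2), of \<one> g] wd_left[OF c(2), of \<one> h] wd_left[OF c(2), of h g] e M dist_sym by auto
  have e3: "wd g (y \<otimes> g) = wl y" "wd (y \<otimes> g) g = wl y"
    using wd_left[OF c(1), of \<one> y] comm e M dist_sym[OF M(3,4)] by auto
  have e4: "wd \<one> (y \<otimes> g) = wl (g \<otimes> y)" "wd (y \<otimes> g) \<one> = wl (g \<otimes> y)" "wd y g = wl (inv y \<otimes> g)" "wd g y = wl (inv y \<otimes> g)"
    using wd_one[OF M(4)] comm dist_sym[OF M(1,4)] dist_sym[OF M(2,3)] by (simp_all add: word_dist_def)
  \<comment> \<open>The two lengths are the diagonals of the quadrilateral on \<open>\<one>\<close>,
    \<open>y\<close>, \<open>g\<close> and \<open>y \<otimes> g\<close>, whose sides have lengths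
    \<open>wl g\<close> and \<open>wl y\<close>. Minimality bounds each diagonal from below, so the
    bound on the sum bounds each from above.\<close>
  have "real (wl (g \<otimes> y)) + real (wl (inv y \<otimes> g)) \<le> 2 * ?d + 2 * \<delta>"
    using fp[OF M(1) M(2) M(3) M(4)] e e2 e3 e4 min y by (auto simp: max_def split: if_splits)
  then have b: "real (wl (g \<otimes> y)) \<le> ?d + 2 * \<delta>" "real (wl (inv y \<otimes> g)) \<le> ?d + 2 * \<delta>"
    using min by auto
  have ss: "real (wl g - s) = ?d - real s" "2 * real s \<le> ?d" "?d \<le> 4 * real s" "2 * real (wl y) \<le> ?d"
    using s y by auto
  \<comment> \<open>Up to \<open>4 * \<delta>\<close>, \<open>y \<otimes> h\<close> is no farther
    from \<open>\<one>\<close> and \<open>g\<close> than \<open>h\<close> is; the assumptions on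
    \<open>s\<close> and \<open>wl y\<close> keep the other term of each maximum small. Two points
    at nearly the same place between \<open>\<one>\<close> and \<open>g\<close> are then
    close.\<close>
  have 1: "real (wd \<one> (y \<otimes> h)) \<le> real s + 4 * \<delta>"
    using fp[OF M(2) M(1) M(6) M(4)] e e2 e3 e4 b ss hyp(2) by (auto simp: max_def split: if_splits)
  have 2: "real (wd g (y \<otimes> h)) \<le> ?d - real s + 4 * \<delta>"
    using fp[OF M(2) M(3) M(6) M(4)] e e2 e3 e4 b ss hyp(2) by (auto simp: max_def split: if_splits)
  have "real (wd h (y \<otimes> h)) + ?d \<le> max (real s + real (wd (y \<otimes> h) g)) (real (wl g - s) + real (wd \<one> (y \<otimes> h))) + 2 * \<delta>"
    using fp[OF M(1) M(5) M(6) M(3)] e dist_sym[OF M(3) M(6)] by (auto simp: max_def split: if_splits)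
  moreover have "wd (y \<otimes> h) g = wd g (y \<otimes> h)" using dist_sym M by blast
  ultimately have "real (wd h (y \<otimes> h)) \<le> 6 * \<delta>"
    using 1 2 ss by (auto simp: max_def split: if_splits)
  then show ?thesis using c by (simp add: word_dist_def m_assoc)
qed

text \<open>By pigeonhole, twice. Elements of \<open>C\<close> lie in different cosets of
  \<open>\<langle>z\<rangle>\<close>, so if \<open>C\<close> is infinite, some coset misses the
  finite ball of radius \<open>R\<close>. Conjugation by the midpoint \<open>h\<close> of its
  shortest element then sends \<open>m + 1\<close> different powers of \<open>z\<close> into a ball
  with only \<open>m - 1\<close> elements.\<close>

theorem finite_centralizing_transversal:
  assumes hyp: "four_point (carrier G) wd \<delta>"
    and z: "z \<in> carrier G" "\<And>i::nat. z [^] i = \<one> \<Longrightarrow> i = 0"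
    and C: "C \<subseteq> carrier G" "\<And>c. c \<in> C \<Longrightarrow> c \<otimes> z = z \<otimes> c"
    and inj: "\<And>c c' i. c \<in> C \<Longrightarrow> c' \<in> C \<Longrightarrow> c' = c \<otimes> z [^] (i::int) \<Longrightarrow> c = c'"
  shows "finite C"
proof (rule ccontr)
  assume inf: "infinite C"
  define \<delta>1 where "\<delta>1 = max \<delta> 0"
  have hyp1: "four_point (carrier G) wd \<delta>1" "0 \<le> \<delta>1"
    using four_point_mono[OF hyp] by (auto simp: \<delta>1_def)
  define r where "r = nat \<lfloor>6 * \<delta>1\<rfloor>"
  define m where "m = card (word_ball G S r) + 1"
  \<comment> \<open>Room for \<open>m\<close> powers of \<open>z\<close> at half the length of
    \<open>g\<close>; the summand 4 makes \<open>wl g \<le> 4 * h0\<close> survive the rounding in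
    \<open>h0\<close>.\<close>
  define R where "R = 2 * (m * wl z) + 4"
  have zc: "z [^] (i::int) \<in> carrier G" for i using z by simp
  obtain c where c: "c \<in> C" "\<And>i::int. R < wl (c \<otimes> z [^] i)"
  proof (rule ccontr)
    assume "\<not> thesis"
    then have "\<forall>c\<in>C. \<exists>i::int. wl (c \<otimes> z [^] i) \<le> R" using that by (meson not_less)
    then obtain k :: "'g \<Rightarrow> int" where k: "\<And>c. c \<in> C \<Longrightarrow> wl (c \<otimes> z [^] k c) \<le> R" by metis
    have "inj_on (\<lambda>c. c \<otimes> z [^] k c) C"
    proof (rule inj_onI)
      fix a b assume ab: "a \<in> C" "b \<in> C" "a \<otimes> z [^] k a = b \<otimes> z [^] k b"
      have split: "x \<otimes> z [^] (i + - j) = (x \<otimes> z [^] i) \<otimes> z [^] (- j)" if "x \<in> C" for x and i j :: int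
        using C(1) that z(1) zc by (simp only: int_pow_mult m_assoc subsetD)
      have "a \<otimes> z [^] (k a + - k b) = b \<otimes> z [^] (k b + - k b)"
        unfolding split[OF ab(1)] split[OF ab(2)] ab(3) ..
      also have "\<dots> = b" using C(1) ab by auto
      finally show "a = b" using inj[OF ab(1,2), of "k a - k b"] by simp
    qed
    moreover have "(\<lambda>c. c \<otimes> z [^] k c) ` C \<subseteq> word_ball G S R"
      using k wl_le_iff C(1) zc by (auto simp: subset_iff)
    ultimately show False using inf word_ball_finite[OF fin] finite_subset finite_imageD by metis
  qed
  have cG: "c \<in> carrier G" using c C by blast
  define n where "n = (LEAST n. \<exists>i::int. wl (c \<otimes> z [^] i) = n)"
  have "\<exists>i::int. wl (c \<otimes> z [^] i) = n" unfolding n_def by (rule LeastI_ex) blast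
  then obtain i0 :: int where i0: "wl (c \<otimes> z [^] i0) = n" by blast
  have nmin: "n \<le> wl (c \<otimes> z [^] i)" for i :: int unfolding n_def by (rule Least_le) blast
  define g where "g = c \<otimes> z [^] i0"
  have g: "g \<in> carrier G" "wl g = n" "R < n" using cG zc i0 c(2) unfolding g_def by auto
  define h0 where "h0 = n div 2"
  obtain h where h: "h \<in> carrier G" "wl h = h0" "wl (inv h \<otimes> g) = n - h0"
    using wl_split[of g h0 "n - h0"] g unfolding h0_def by auto
  have cz: "c \<otimes> z [^] i = z [^] i \<otimes> c" for i :: int
    using int_pow_commute[OF cG z(1) C(2)[OF c(1)]] .
  have conj: "inv h \<otimes> z [^] i \<otimes> h \<in> word_ball G S r" if "i \<le> m" for i :: nat
  proof -
    let ?y = "z [^] i"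
    have y: "?y \<in> carrier G" "?y = z [^] int i" "inv ?y = z [^] (- int i)"
      using z by (auto simp: int_pow_int int_pow_neg)
    have gy: "g \<otimes> ?y = c \<otimes> z [^] (i0 + int i)"
      unfolding g_def y(2) using cG zc z by (simp add: m_assoc int_pow_mult)
    have comm: "g \<otimes> ?y = ?y \<otimes> g"
    proof -
      have "?y \<otimes> g = c \<otimes> (?y \<otimes> z [^] i0)"
        unfolding g_def y(2) using cz cG zc by (metis m_assoc)
      also have "\<dots> = c \<otimes> z [^] (int i + i0)" unfolding y(2) using z by (simp add: int_pow_mult)
      finally show ?thesis using gy by (simp add: add.commute)
    qed
    have "inv ?y \<otimes> g = c \<otimes> z [^] (- int i + i0)"
    proof -
      have "inv ?y \<otimes> g = c \<otimes> (z [^] (- int i) \<otimes> z [^] i0)"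
        unfolding g_def y(3) using cz cG zc by (metis m_assoc)
      then show ?thesis by (simp only: int_pow_mult[OF z(1)])
    qed
    then have mins: "wl g \<le> wl (g \<otimes> ?y)" "wl g \<le> wl (inv ?y \<otimes> g)" using gy nmin g by auto
    have "wl ?y \<le> m * wl z" using wl_pow[OF z(1), of i] that by (meson le_trans mult_le_mono1)
    then have "2 * wl ?y \<le> wl g" using g R_def by simp
    moreover have "wl g \<le> 4 * h0" "2 * h0 \<le> wl g" using g R_def unfolding h0_def by auto
    ultimately have "real (wl (inv h \<otimes> ?y \<otimes> h)) \<le> 6 * \<delta>1"
      using midpoint_conjugate[OF hyp1 g(1) y(1) h(1) comm mins _ h(2)] h(3) g(2) by simp
    then have "wl (inv h \<otimes> ?y \<otimes> h) \<le> r" unfolding r_def by linarith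
    then show ?thesis using wl_le_iff h y by simp
  qed
  have "inj_on (\<lambda>i::nat. inv h \<otimes> z [^] i \<otimes> h) {..m}"
  proof (rule linorder_inj_onI)
    fix i j :: nat assume ij: "i < j" "i \<in> {..m}" "j \<in> {..m}"
    show "inv h \<otimes> z [^] i \<otimes> h \<noteq> inv h \<otimes> z [^] j \<otimes> h"
    proof
      assume "inv h \<otimes> z [^] i \<otimes> h = inv h \<otimes> z [^] j \<otimes> h"
      then have "z [^] i = z [^] j" using h z by simp
      then have "z [^] (j - i) = \<one>"
        using pow_eq_div2[of z j i] z ij by simp
      then show False using z(2) ij by fastforce
    qed
  qed auto
  then have "card {..m} \<le> card (word_ball G S r)"
    using conj by (intro card_inj_on_le[of "\<lambda>i::nat. inv h \<otimes> z [^] i \<otimes> h"] word_ball_finite fin) auto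
  then show False unfolding m_def by simp
qed

end

section \<open>Actions of HNN extensions\<close>

locale hnn = group H for H :: "('a, 'b) monoid_scheme" (structure) +
  fixes phi :: "'a \<Rightarrow> 'a" and K :: "'a set"
  assumes phi: "phi \<in> iso H H" and K: "subgroup K H"
begin

abbreviation "rel \<equiv> hnn_rel H phi K"
abbreviation "cls \<equiv> hnn_class H phi K"
abbreviation "G \<equiv> HNN H phi K"
abbreviation "valid \<equiv> hnn_valid H"
abbreviation "psi \<equiv> inv_into (carrier H) phi"
abbreviation (input) "\<iota> h \<equiv> cls [(Some h, False)]"
abbreviation (input) "T \<equiv> cls [(None, False)]"

lemma K_carrier: "k \<in> K \<Longrightarrow> k \<in> carrier H"
  using subgroup.subset[OF K] by blast

lemma phi_bij: "bij_betw phi (carrier H) (carrier H)"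
  using phi by (simp add: iso_def)

lemma phi_closed: "h \<in> carrier H \<Longrightarrow> phi h \<in> carrier H"
  using phi_bij bij_betwE by blast

lemma phi_mult: "h \<in> carrier H \<Longrightarrow> k \<in> carrier H \<Longrightarrow> phi (h \<otimes> k) = phi h \<otimes> phi k"
  using phi by (simp add: iso_def hom_mult)

lemma psi_closed: "h \<in> carrier H \<Longrightarrow> psi h \<in> carrier H"
  using phi_bij by (metis bij_betw_imp_surj_on inv_into_into)

lemma phi_psi: "h \<in> carrier H \<Longrightarrow> phi (psi h) = h"
  using phi_bij by (metis bij_betw_inv_into_right)

lemma psi_phi: "h \<in> carrier H \<Longrightarrow> psi (phi h) = h"
  using phi_bij by (metis bij_betw_inv_into_left)

lemma phi_hom: "group_hom H H phi"
  using phi by unfold_locales (simp add: iso_def)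

lemma phi_one: "phi \<one> = \<one>"
  using group_hom.hom_one[OF phi_hom] .

lemma phi_inv: "h \<in> carrier H \<Longrightarrow> phi (inv h) = inv (phi h)"
  using group_hom.hom_inv[OF phi_hom] .

lemma psi_mult: "h \<in> carrier H \<Longrightarrow> k \<in> carrier H \<Longrightarrow> psi (h \<otimes> k) = psi h \<otimes> psi k"
  by (metis phi_mult phi_psi psi_closed psi_phi m_closed)

lemma valid_simps [simp]:
  "valid []" "valid (l # w) \<longleftrightarrow> hnn_valid_letter H l \<and> valid w"
  "valid (u @ v) \<longleftrightarrow> valid u \<and> valid v"
  "hnn_valid_letter H (None, e)" "hnn_valid_letter H (Some h, e) \<longleftrightarrow> h \<in> carrier H"
  unfolding hnn_valid_def hnn_valid_letter_def by auto

lemma valid_letter_flip: "hnn_valid_letter H (x, e) \<longleftrightarrow> hnn_valid_letter H (x, e')"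
  unfolding hnn_valid_letter_def by simp

lemma rel_valid: "rel u v \<Longrightarrow> valid u \<and> valid v"
proof (induction rule: hnn_rel.induct)
  case (free1 x) then show ?case using valid_letter_flip by auto
next
  case (free2 x) then show ?case using valid_letter_flip by auto
qed (auto intro: K_carrier phi_closed)

lemma cls_eq: "rel u v \<Longrightarrow> cls u = cls v"
  unfolding hnn_class_def using hnn_rel.sym hnn_rel.trans by blast

lemma cls_eq_iff: "valid u \<Longrightarrow> cls u = cls v \<longleftrightarrow> rel v u"
  using cls_eq hnn_rel.refl hnn_rel.sym unfolding hnn_class_def by blast

lemma rel_append: "rel u u' \<Longrightarrow> rel v v' \<Longrightarrow> rel (u @ v) (u' @ v')"
  using hnn_rel.cong[of H phi K u u' "[]" v] hnn_rel.cong[of H phi K v v' u' "[]"] rel_valid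
    hnn_rel.trans by fastforce

lemma G_mult: "valid u \<Longrightarrow> valid v \<Longrightarrow> cls u \<otimes>\<^bsub>G\<^esub> cls v = cls (u @ v)"
proof -
  assume uv: "valid u" "valid v"
  have "(\<exists>x\<in>cls u. \<exists>y\<in>cls v. rel (x @ y) w) \<longleftrightarrow> rel (u @ v) w" for w
  proof
    assume "\<exists>x\<in>cls u. \<exists>y\<in>cls v. rel (x @ y) w"
    then show "rel (u @ v) w" unfolding hnn_class_def using rel_append hnn_rel.trans by blast
  next
    assume "rel (u @ v) w"
    then show "\<exists>x\<in>cls u. \<exists>y\<in>cls v. rel (x @ y) w"
      unfolding hnn_class_def using hnn_rel.refl[OF uv(1)] hnn_rel.refl[OF uv(2)] by blast
  qed
  then show ?thesis unfolding HNN_def by (simp add: hnn_class_def[of _ _ _ "u @ v"])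
qed

lemma G_one: "\<one>\<^bsub>G\<^esub> = cls []"
  unfolding HNN_def by simp

lemma G_carrier: "g \<in> carrier G \<longleftrightarrow> (\<exists>u. valid u \<and> g = cls u)"
  unfolding HNN_def by auto

lemma cls_carrier [simp]: "valid u \<Longrightarrow> cls u \<in> carrier G"
  using G_carrier by blast

lemma G_inverse: "valid u \<Longrightarrow> \<exists>v. valid v \<and> rel (v @ u) []"
proof (induction u)
  case Nil
  then show ?case using hnn_rel.refl by fastforce
next
  case (Cons l u)
  then obtain v where v: "valid v" "rel (v @ u) []" by auto
  obtain x e where l: "l = (x, e)" by fastforce
  have "rel [(x, \<not> e), l] []"
    using Cons.prems l hnn_rel.free1[of H x phi K] hnn_rel.free2[of H x phi K] valid_letter_flip
    by (cases e) auto
  then have "rel (v @ [(x, \<not> e), l] @ u) (v @ [] @ u)"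
    using hnn_rel.cong v(1) Cons.prems by (metis valid_simps(2))
  then have "rel ((v @ [(x, \<not> e)]) @ l # u) []" using v(2) hnn_rel.trans by fastforce
  moreover have "valid (v @ [(x, \<not> e)])" using v l Cons.prems valid_letter_flip by auto
  ultimately show ?case by blast
qed

lemma group_G: "group G"
proof (rule groupI)
  show "x \<otimes>\<^bsub>G\<^esub> y \<in> carrier G" if "x \<in> carrier G" "y \<in> carrier G" for x y
    using that G_mult G_carrier by (metis valid_simps(3))
  show "\<one>\<^bsub>G\<^esub> \<in> carrier G" using G_one by simp
  show "x \<otimes>\<^bsub>G\<^esub> y \<otimes>\<^bsub>G\<^esub> z = x \<otimes>\<^bsub>G\<^esub> (y \<otimes>\<^bsub>G\<^esub> z)" if "x \<in> carrier G" "y \<in> carrier G" "z \<in> carrier G" for x y z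
    using that unfolding G_carrier by (auto simp: G_mult)
  show "\<one>\<^bsub>G\<^esub> \<otimes>\<^bsub>G\<^esub> x = x" if "x \<in> carrier G" for x
    using that unfolding G_carrier G_one by (auto simp: G_mult)
  show "\<exists>y\<in>carrier G. y \<otimes>\<^bsub>G\<^esub> x = \<one>\<^bsub>G\<^esub>" if x: "x \<in> carrier G" for x
  proof -
    obtain u where u: "valid u" "x = cls u" using x G_carrier by blast
    obtain v where v: "valid v" "rel (v @ u) []" using G_inverse u by blast
    then have "cls v \<otimes>\<^bsub>G\<^esub> x = \<one>\<^bsub>G\<^esub>" using u G_mult cls_eq G_one by simp
    then show ?thesis using v by (intro bexI[of _ "cls v"]) auto
  qed
qed

sublocale G: group G by (rule group_G)

lemma iota_mult: "h \<in> carrier H \<Longrightarrow> k \<in> carrier H \<Longrightarrow> \<iota> h \<otimes>\<^bsub>G\<^esub> \<iota> k = \<iota> (h \<otimes> k)"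
  by (simp add: G_mult cls_eq[OF hnn_rel.rel_mult])

lemma iota_one: "\<iota> \<one> = \<one>\<^bsub>G\<^esub>"
  by (simp add: G_one cls_eq[OF hnn_rel.rel_one])

lemma iota_inv: "h \<in> carrier H \<Longrightarrow> \<iota> (inv h) = inv\<^bsub>G\<^esub> (\<iota> h)"
  by (rule G.inv_equality[symmetric]) (auto simp: iota_mult iota_one)

lemma cls_flip:
  assumes x: "hnn_valid_letter H (x, False)"
  shows "cls [(x, True)] = inv\<^bsub>G\<^esub> (cls [(x, False)])"
proof -
  have v: "valid [(x, False)]" "valid [(x, True)]" using x valid_letter_flip[of x False True] by simp_all
  then show ?thesis
    by (intro G.inv_equality[symmetric]) (simp_all only: G_mult G_one cls_carrier append.simps cls_eq[OF hnn_rel.free2[OF x]])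
qed

lemma T_iota:
  assumes "k \<in> K" shows "T \<otimes>\<^bsub>G\<^esub> \<iota> k = \<iota> (phi k) \<otimes>\<^bsub>G\<^esub> T"
proof -
  have c: "T \<in> carrier G" "\<iota> k \<in> carrier G" "\<iota> (phi k) \<in> carrier G"
    using K_carrier[OF assms] phi_closed by auto
  have "(T \<otimes>\<^bsub>G\<^esub> \<iota> k) \<otimes>\<^bsub>G\<^esub> inv\<^bsub>G\<^esub> T = \<iota> (phi k)"
    using cls_eq[OF hnn_rel.conj[OF assms]] K_carrier[OF assms] by (simp add: G_mult cls_flip[symmetric])
  then show ?thesis using c by (metis G.inv_solve_right' G.m_closed)
qed

lemma inv_T_iota:
  assumes "k \<in> K" shows "inv\<^bsub>G\<^esub> T \<otimes>\<^bsub>G\<^esub> \<iota> (phi k) = \<iota> k \<otimes>\<^bsub>G\<^esub> inv\<^bsub>G\<^esub> T"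
proof -
  have c: "T \<in> carrier G" "\<iota> k \<in> carrier G" "\<iota> (phi k) \<in> carrier G"
    using K_carrier[OF assms] phi_closed by auto
  have "inv\<^bsub>G\<^esub> T \<otimes>\<^bsub>G\<^esub> \<iota> (phi k) \<otimes>\<^bsub>G\<^esub> T = \<iota> k"
    using T_iota[OF assms] c by (metis G.inv_solve_left' G.m_assoc G.inv_closed G.m_closed)
  then show ?thesis using c by (metis G.inv_solve_right G.inv_closed G.m_closed)
qed

end

text \<open>These are the defining relations, tested on single letters; \<open>act_rel\<close>
  extends them to words. \<open>st_cancel\<close> covers both orders of free cancellation, as
  \<open>e\<close> is arbitrary.\<close>

locale hnn_action = hnn +
  fixes M :: "'s set" and st :: "'a hnn_letter \<Rightarrow> 's \<Rightarrow> 's"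
  assumes st_closed: "hnn_valid_letter H l \<Longrightarrow> s \<in> M \<Longrightarrow> st l s \<in> M"
    and st_cancel: "hnn_valid_letter H (x, e) \<Longrightarrow> s \<in> M \<Longrightarrow> st (x, e) (st (x, \<not> e) s) = s"
    and st_mult: "h \<in> carrier H \<Longrightarrow> k \<in> carrier H \<Longrightarrow> s \<in> M \<Longrightarrow>
      st (Some h, False) (st (Some k, False) s) = st (Some (h \<otimes> k), False) s"
    and st_one: "s \<in> M \<Longrightarrow> st (Some \<one>, False) s = s"
    and st_conj: "k \<in> K \<Longrightarrow> s \<in> M \<Longrightarrow>
      st (None, False) (st (Some k, False) (st (None, True) s)) = st (Some (phi k), False) s"
begin

definition act :: "'a hnn_letter list \<Rightarrow> 's \<Rightarrow> 's" where
  "act u s = foldr st u s"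

lemma act_simps [simp]: "act [] s = s" "act (l # u) s = st l (act u s)" "act (u @ v) s = act u (act v s)"
  unfolding act_def by auto

lemma act_closed: "valid u \<Longrightarrow> s \<in> M \<Longrightarrow> act u s \<in> M"
  by (induction u) (auto intro: st_closed)

lemma act_rel: "rel u v \<Longrightarrow> s \<in> M \<Longrightarrow> act u s = act v s"
proof (induction arbitrary: s rule: hnn_rel.induct)
  case (cong u v a b)
  then show ?case using act_closed by simp
next
  case (free1 x)
  then show ?case using st_cancel[of x False s] by simp
next
  case (free2 x)
  then show ?case using st_cancel[of x True s] valid_letter_flip[of x False True] by simp
qed (auto simp: st_mult st_one st_conj)

definition gact :: "'a hnn_letter list set \<Rightarrow> 's \<Rightarrow> 's" where
  "gact g s = act (SOME u. u \<in> g) s"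

lemma gact_cls: "valid u \<Longrightarrow> s \<in> M \<Longrightarrow> gact (cls u) s = act u s"
proof -
  assume u: "valid u" "s \<in> M"
  then have "u \<in> cls u" unfolding hnn_class_def using hnn_rel.refl by blast
  then have "(SOME v. v \<in> cls u) \<in> cls u" by (rule someI)
  then show ?thesis unfolding gact_def using act_rel u unfolding hnn_class_def by fastforce
qed

lemma gact_closed: "g \<in> carrier G \<Longrightarrow> s \<in> M \<Longrightarrow> gact g s \<in> M"
  using gact_cls act_closed G_carrier by auto

lemma gact_mult: "g \<in> carrier G \<Longrightarrow> h \<in> carrier G \<Longrightarrow> s \<in> M \<Longrightarrow> gact (g \<otimes>\<^bsub>G\<^esub> h) s = gact g (gact h s)"
  unfolding G_carrier by (auto simp: G_mult gact_cls act_closed)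

lemma gact_one: "s \<in> M \<Longrightarrow> gact \<one>\<^bsub>G\<^esub> s = s"
  unfolding G_one by (simp add: gact_cls)

lemma gact_inv: "g \<in> carrier G \<Longrightarrow> s \<in> M \<Longrightarrow> gact (inv\<^bsub>G\<^esub> g) (gact g s) = s"
  using gact_mult[of "inv\<^bsub>G\<^esub> g" g s] gact_one by simp

end

text \<open>An \<open>H\<close>-set \<open>Y\<close> on which \<open>f\<close> realizes \<open>phi\<close> becomes a \<open>G\<close>-set \<open>Y \<times> P\<close>: the
  stable letter acts by \<open>f\<close> on \<open>Y\<close> and moves the fibre by a permutation that is
  constant on \<open>K\<close>-orbits, which is exactly what the HNN relations ask for.\<close>

locale hnn_twist = hnn +
  fixes Y :: "'y set" and la :: "'a \<Rightarrow> 'y \<Rightarrow> 'y" and f g :: "'y \<Rightarrow> 'y" and \<kappa> :: "'y \<Rightarrow> 'c"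
    and P :: "'p set" and \<sigma> \<sigma>' :: "'c \<Rightarrow> 'p \<Rightarrow> 'p"
  assumes la_closed: "h \<in> carrier H \<Longrightarrow> y \<in> Y \<Longrightarrow> la h y \<in> Y"
    and la_mult: "h \<in> carrier H \<Longrightarrow> k \<in> carrier H \<Longrightarrow> y \<in> Y \<Longrightarrow> la h (la k y) = la (h \<otimes> k) y"
    and la_one: "y \<in> Y \<Longrightarrow> la \<one> y = y"
    and f_closed: "y \<in> Y \<Longrightarrow> f y \<in> Y" and g_closed: "y \<in> Y \<Longrightarrow> g y \<in> Y"
    and fg: "y \<in> Y \<Longrightarrow> f (g y) = y" and gf: "y \<in> Y \<Longrightarrow> g (f y) = y"
    and f_la: "h \<in> carrier H \<Longrightarrow> y \<in> Y \<Longrightarrow> f (la h y) = la (phi h) (f y)"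
    and \<kappa>_K: "k \<in> K \<Longrightarrow> y \<in> Y \<Longrightarrow> \<kappa> (la k y) = \<kappa> y"
    and \<sigma>_closed: "y \<in> Y \<Longrightarrow> p \<in> P \<Longrightarrow> \<sigma> (\<kappa> y) p \<in> P" and \<sigma>'_closed: "y \<in> Y \<Longrightarrow> p \<in> P \<Longrightarrow> \<sigma>' (\<kappa> y) p \<in> P"
    and \<sigma>\<sigma>': "y \<in> Y \<Longrightarrow> p \<in> P \<Longrightarrow> \<sigma> (\<kappa> y) (\<sigma>' (\<kappa> y) p) = p"
    and \<sigma>'\<sigma>: "y \<in> Y \<Longrightarrow> p \<in> P \<Longrightarrow> \<sigma>' (\<kappa> y) (\<sigma> (\<kappa> y) p) = p"
begin

fun step :: "'a hnn_letter \<Rightarrow> 'y \<times> 'p \<Rightarrow> 'y \<times> 'p" where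
  "step (Some h, False) (y, p) = (la h y, p)"
| "step (Some h, True) (y, p) = (la (inv h) y, p)"
| "step (None, False) (y, p) = (f y, \<sigma> (\<kappa> y) p)"
| "step (None, True) (y, p) = (g y, \<sigma>' (\<kappa> (g y)) p)"

sublocale hnn_action H phi K "Y \<times> P" step
proof
  show "step l s \<in> Y \<times> P" if "hnn_valid_letter H l" "s \<in> Y \<times> P" for l s
    using that
    by (cases "(l, s)" rule: step.cases) (auto simp: la_closed f_closed g_closed \<sigma>_closed \<sigma>'_closed)
  show "step (x, e) (step (x, \<not> e) s) = s" if "hnn_valid_letter H (x, e)" "s \<in> Y \<times> P" for x e s
    using that
    by (cases s; cases x; cases e) (auto simp: la_mult la_one fg gf g_closed \<sigma>\<sigma>' \<sigma>'\<sigma>)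
  show "step (Some h, False) (step (Some k, False) s) = step (Some (h \<otimes> k), False) s"
    if "h \<in> carrier H" "k \<in> carrier H" "s \<in> Y \<times> P" for h k s
    using that by (cases s) (auto simp: la_mult)
  show "step (Some \<one>, False) s = s" if "s \<in> Y \<times> P" for s
    using that by (cases s) (auto simp: la_one)
  show "step (None, False) (step (Some k, False) (step (None, True) s)) = step (Some (phi k), False) s"
    if "k \<in> K" "s \<in> Y \<times> P" for k s
    using that K_carrier by (cases s) (auto simp: g_closed f_la fg \<kappa>_K \<sigma>\<sigma>')
qed

end

context hnn
begin

lemma coset_K: "k \<in> K \<Longrightarrow> y \<in> carrier H \<Longrightarrow> K #> (k \<otimes> y) = K #> y"
  using subgroup.subset[OF K] K_carrier by (simp add: coset_mult_assoc[symmetric] coset_join2[OF _ K])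

text \<open>The action on \<open>H \<times> \<int>\<close> is there to show that \<open>z\<close> has infinite order.\<close>

theorem finite_K:
  assumes hyp: "hyperbolic_group G"
    and n: "n \<in> carrier H" "n \<notin> K" "\<And>k. k \<in> K \<Longrightarrow> n \<otimes> k \<otimes> inv n \<in> K"
  shows "finite K"
proof -
  interpret A: hnn_twist H phi K "carrier H" "(\<otimes>)" phi psi "\<lambda>y. K #> y" UNIV
    "\<lambda>c p :: int. if c = K then p + 1 else p" "\<lambda>c p. if c = K then p - 1 else p"
    by unfold_locales (auto simp: m_assoc phi_closed psi_closed phi_psi psi_phi phi_mult coset_K)
  define z where "z = inv\<^bsub>G\<^esub> (\<iota> n) \<otimes>\<^bsub>G\<^esub> (inv\<^bsub>G\<^esub> T \<otimes>\<^bsub>G\<^esub> (\<iota> (phi n) \<otimes>\<^bsub>G\<^esub> T))"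
  have z: "z \<in> carrier G" unfolding z_def using n phi_closed by simp
  have zw: "z = cls [(Some n, True), (None, True), (Some (phi n), False), (None, False)]"
    unfolding z_def using n phi_closed by (simp add: cls_flip[symmetric] G_mult)
  have comm: "\<iota> k \<otimes>\<^bsub>G\<^esub> z = z \<otimes>\<^bsub>G\<^esub> \<iota> k" if k: "k \<in> K" for k
  proof -
    define k' where "k' = n \<otimes> k \<otimes> inv n"
    have k': "k' \<in> K" "k' \<in> carrier H" using n(3)[OF k] K_carrier by (auto simp: k'_def)
    have kc: "k \<in> carrier H" using K_carrier k by blast
    have nk: "n \<otimes> k = k' \<otimes> n" unfolding k'_def using n kc by (simp add: m_assoc)
    have nk': "k \<otimes> inv n = inv n \<otimes> k'" unfolding k'_def using n kc by (simp add: m_assoc[symmetric])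
    have "z \<otimes>\<^bsub>G\<^esub> \<iota> k = \<iota> (inv n) \<otimes>\<^bsub>G\<^esub> (inv\<^bsub>G\<^esub> T \<otimes>\<^bsub>G\<^esub> (\<iota> (phi n) \<otimes>\<^bsub>G\<^esub> (T \<otimes>\<^bsub>G\<^esub> \<iota> k)))"
      unfolding z_def using n kc phi_closed by (simp add: G.m_assoc iota_inv)
    also have "\<dots> = \<iota> (inv n) \<otimes>\<^bsub>G\<^esub> (inv\<^bsub>G\<^esub> T \<otimes>\<^bsub>G\<^esub> ((\<iota> (phi n) \<otimes>\<^bsub>G\<^esub> \<iota> (phi k)) \<otimes>\<^bsub>G\<^esub> T))"
      unfolding T_iota[OF k] using n kc phi_closed by (simp add: G.m_assoc)
    also have "\<iota> (phi n) \<otimes>\<^bsub>G\<^esub> \<iota> (phi k) = \<iota> (phi k') \<otimes>\<^bsub>G\<^esub> \<iota> (phi n)"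
      using n kc k' phi_closed by (simp add: iota_mult phi_mult[symmetric] nk)
    also have "inv\<^bsub>G\<^esub> T \<otimes>\<^bsub>G\<^esub> (\<iota> (phi k') \<otimes>\<^bsub>G\<^esub> \<iota> (phi n) \<otimes>\<^bsub>G\<^esub> T) = (inv\<^bsub>G\<^esub> T \<otimes>\<^bsub>G\<^esub> \<iota> (phi k')) \<otimes>\<^bsub>G\<^esub> (\<iota> (phi n) \<otimes>\<^bsub>G\<^esub> T)"
      using n k' phi_closed by (simp add: G.m_assoc)
    also have "\<iota> (inv n) \<otimes>\<^bsub>G\<^esub> \<dots> = (\<iota> (inv n) \<otimes>\<^bsub>G\<^esub> \<iota> k') \<otimes>\<^bsub>G\<^esub> (inv\<^bsub>G\<^esub> T \<otimes>\<^bsub>G\<^esub> (\<iota> (phi n) \<otimes>\<^bsub>G\<^esub> T))"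
      unfolding inv_T_iota[OF k'(1)] using n k' phi_closed by (simp add: G.m_assoc)
    also have "\<iota> (inv n) \<otimes>\<^bsub>G\<^esub> \<iota> k' = \<iota> k \<otimes>\<^bsub>G\<^esub> \<iota> (inv n)"
      using n kc k' by (simp add: iota_mult nk')
    finally show ?thesis unfolding z_def using n kc phi_closed by (simp add: G.m_assoc iota_inv)
  qed
  have Kn: "K #> n \<noteq> K"
    using n by (metis coset_join1 subgroup.subset[OF K] K)
  \<comment> \<open>Read from the right: t passes over \<open>K\<close> and adds 1;
    \<open>phi n\<close> moves \<open>\<one>\<close> to \<open>phi n\<close>; the inverse of t leads
    over \<open>n\<close>, whose coset is not \<open>K\<close>, so nothing is subtracted;
    \<open>inv n\<close> returns to \<open>\<one>\<close>.\<close>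
  have zact: "A.gact z (\<one>, p) = (\<one>, p + 1)" for p
    unfolding zw using n phi_closed Kn subgroup.subset[OF K]
    by (simp add: A.gact_cls phi_one psi_phi)
  have zpow: "A.gact (z [^]\<^bsub>G\<^esub> (i::nat)) (\<one>, p) = (\<one>, p + int i)" for i p
  proof (induction i arbitrary: p)
    case 0
    then show ?case by (simp add: A.gact_one)
  next
    case (Suc i)
    then show ?case using z by (simp add: A.gact_mult zact)
  qed
  have iact: "A.gact (\<iota> h) (\<one>, p) = (h, p)" if "h \<in> carrier H" for h p
    using that by (simp add: A.gact_cls)
  \<comment> \<open>Powers of \<open>z\<close> leave the first coordinate \<open>\<one>\<close>
    alone, so comparing first coordinates on both sides yields \<open>h = k\<close>.\<close>
  have eq_nat: "h = k" if hk: "h \<in> carrier H" "k \<in> carrier H" "\<iota> k = \<iota> h \<otimes>\<^bsub>G\<^esub> z [^]\<^bsub>G\<^esub> (i::nat)" for h k i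
  proof -
    have "A.gact (\<iota> k) (\<one>, 0) = A.gact (\<iota> h) (A.gact (z [^]\<^bsub>G\<^esub> i) (\<one>, 0))"
      unfolding hk(3) using hk z by (intro A.gact_mult) auto
    then show ?thesis using hk(1,2) by (simp add: zpow iact)
  qed
  obtain S \<delta> where S: "finite S" "S \<subseteq> carrier G" "generate G S = carrier G"
    and \<delta>: "\<forall>w\<in>carrier G. \<forall>x\<in>carrier G. \<forall>y\<in>carrier G. \<forall>z\<in>carrier G.
      gromov_product G S w x y \<ge> min (gromov_product G S w x z) (gromov_product G S w z y) - \<delta>"
    using hyp unfolding hyperbolic_group_def by blast
  interpret W: word_metric G S using S by unfold_locales
  have "finite ((\<lambda>k. \<iota> k) ` K)"
  proof (rule W.finite_centralizing_transversal[OF iffD2[OF W.four_point_iff \<delta>] z])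
    fix i :: nat assume "z [^]\<^bsub>G\<^esub> i = \<one>\<^bsub>G\<^esub>"
    then show "i = 0" using zpow[of i 0] A.gact_one[of "(\<one>, 0)"] by simp
  next
    show "(\<lambda>k. \<iota> k) ` K \<subseteq> carrier G" using K_carrier by auto
  next
    fix x assume "x \<in> (\<lambda>k. \<iota> k) ` K"
    then show "x \<otimes>\<^bsub>G\<^esub> z = z \<otimes>\<^bsub>G\<^esub> x" using comm by blast
  next
    fix x y and i :: int
    assume "x \<in> (\<lambda>k. \<iota> k) ` K" "y \<in> (\<lambda>k. \<iota> k) ` K" and yx: "y = x \<otimes>\<^bsub>G\<^esub> z [^]\<^bsub>G\<^esub> i"
    then obtain h k where hk: "h \<in> carrier H" "k \<in> carrier H" "x = \<iota> h" "y = \<iota> k" using K_carrier by blast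
    show "x = y"
    proof (cases i rule: int_cases2)
      case (nonneg j)
      then show ?thesis using eq_nat[of h k j] hk yx by (simp add: int_pow_int)
    next
      case (nonpos j)
      then have "y = x \<otimes>\<^bsub>G\<^esub> inv\<^bsub>G\<^esub> (z [^]\<^bsub>G\<^esub> j)" using yx z by (simp add: G.int_pow_neg_int)
      then have "x = y \<otimes>\<^bsub>G\<^esub> z [^]\<^bsub>G\<^esub> j" using hk z by (simp add: G.m_assoc)
      then have "k = h" unfolding hk(3,4) by (rule eq_nat[OF hk(2,1)])
      then show ?thesis unfolding hk(3,4) by simp
    qed
  qed
  moreover have "inj_on (\<lambda>k. \<iota> k) K"
  proof (rule inj_onI)
    fix h k assume hk: "h \<in> K" "k \<in> K" "\<iota> h = \<iota> k"
    have "(h, 0 :: int) = (k, 0)"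
      using iact[OF K_carrier[OF hk(1)], of 0] iact[OF K_carrier[OF hk(2)], of 0] unfolding hk(3) by simp
    then show "h = k" by simp
  qed
  ultimately show ?thesis using finite_imageD by blast
qed

end

section \<open>The vertex group is undistorted\<close>

text \<open>Left multiplication by a generator or its inverse in a free group whose elements are
  represented by reduced words.\<close>

fun push :: "'c \<times> bool \<Rightarrow> ('c \<times> bool) list \<Rightarrow> ('c \<times> bool) list" where
  "push l [] = [l]"
| "push l (l' # w) = (if fst l = fst l' \<and> snd l \<noteq> snd l' then w else l # l' # w)"

fun reduced :: "('c \<times> bool) list \<Rightarrow> bool" where
  "reduced (l # l' # w) \<longleftrightarrow> \<not> (fst l = fst l' \<and> snd l \<noteq> snd l') \<and> reduced (l' # w)"
| "reduced _ \<longleftrightarrow> True"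

lemma reduced_tl: "reduced (l # w) \<Longrightarrow> reduced w"
  by (cases w) auto

lemma reduced_push: "reduced w \<Longrightarrow> reduced (push l w)"
  by (cases w) (auto dest: reduced_tl)

text \<open>If the first \<open>push\<close> cancels a letter, the second must put it back and not
  cancel again; this is where reducedness enters.\<close>

lemma push_push: "reduced w \<Longrightarrow> push (c, \<not> e) (push (c, e) w) = w"
  by (cases w rule: reduced.cases) auto

lemma set_push: "set (push l w) \<subseteq> insert l (set w)"
  by (cases w) auto

context hnn
begin

definition stacks :: "('a set \<times> bool) list set" where
  "stacks = {w. reduced w \<and> fst ` set w \<subseteq> rcosets K}"

lemma push_stacks: "w \<in> stacks \<Longrightarrow> c \<in> rcosets K \<Longrightarrow> push (c, e) w \<in> stacks"
  unfolding stacks_def using set_push[of "(c, e)" w] by (fastforce simp: reduced_push)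

lemma coset_in_rcosets: "y \<in> carrier H \<Longrightarrow> K #> y \<in> rcosets K"
  using rcosetsI[OF subgroup.subset[OF K]] .

text \<open>Over \<open>y\<close> the stable letter pushes the coset of \<open>y\<close>; its
  inverse, arriving over \<open>psi y\<close>, pushes the inverse letter of the coset of
  \<open>psi y\<close>. Recording the coset alone is forced by the relation: t takes
  \<open>k \<otimes> y\<close> and \<open>y\<close> to states that differ by \<open>phi k\<close>
  only.\<close>

sublocale B: hnn_twist H phi K "carrier H" "(\<otimes>)" phi psi "\<lambda>y. K #> y" stacks
    "\<lambda>c. push (c, False)" "\<lambda>c. push (c, True)"
proof unfold_locales
  show "push (K #> y, False) (push (K #> y, True) p) = p" if "y \<in> carrier H" "p \<in> stacks" for y p
    using push_push[of p "K #> y" True] that by (simp add: stacks_def)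
  show "push (K #> y, True) (push (K #> y, False) p) = p" if "y \<in> carrier H" "p \<in> stacks" for y p
    using push_push[of p "K #> y" False] that by (simp add: stacks_def)
qed (auto simp: m_assoc phi_closed psi_closed phi_psi psi_phi phi_mult coset_K push_stacks coset_in_rcosets)

text \<open>While a path of states has a nonempty stack, its eventual position at the bottom
  level is already determined up to the coset stored in the bottom letter.\<close>

fun base :: "'a \<times> ('a set \<times> bool) list \<Rightarrow> 'a set" where
  "base (x, w) = (if w = [] then {x} else if snd (last w) then phi ` fst (last w) else fst (last w))"

lemma base_carrier:
  assumes "s \<in> carrier H \<times> stacks" shows "base s \<subseteq> carrier H"
proof -
  obtain x w where s: "s = (x, w)" by fastforce
  have "c \<subseteq> carrier H" if "c \<in> rcosets K" for c
    using subgroup.rcosets_carrier[OF K is_group that] .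
  then show ?thesis using assms s phi_closed unfolding stacks_def
    by (auto simp: subset_iff image_iff) (metis last_in_set surjective_pairing image_eqI fst_conv)+
qed

lemma self_in_coset: "x \<in> carrier H \<Longrightarrow> x \<in> K #> x"
  using rcos_self[OF _ K] .

text \<open>While the stack stays nonempty, \<open>base\<close> does not change. Leaving the bottom
  level turns \<open>{x}\<close> into the translate of \<open>K\<close>, or of its image under
  \<open>phi\<close>, that contains \<open>x\<close>, at the price of one factor from that subgroup.
  Returning lands on an element of the old \<open>base\<close>. An unchanged \<open>base\<close>
  counts as a factor \<open>\<one>\<close>, which \<open>K\<close> provides.\<close>

lemma base_step:
  assumes KS: "K \<subseteq> S" "phi ` K \<subseteq> S" and SH: "S \<subseteq> carrier H"
    and l: "fst l \<in> insert None (Some ` S)" and s: "s \<in> carrier H \<times> stacks" and y: "y \<in> base (B.step l s)"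
  shows "\<exists>a\<in>S \<union> m_inv H ` S. \<exists>z\<in>base s. y = a \<otimes> z"
proof -
  obtain x w where xw: "s = (x, w)" "x \<in> carrier H" "w \<in> stacks" using s by blast
  have one: "\<one> \<in> S" using KS subgroup.one_closed[OF K] by blast
  have keep: ?thesis if "y \<in> base s"
    using that one base_carrier[OF s] by (intro bexI[of _ \<one>] bexI[of _ y]) auto
  consider (h) h e where "l = (Some h, e)" "h \<in> S" | (t) e where "l = (None, e)"
    using l by (cases l) auto
  then show ?thesis
  proof cases
    case h
    show ?thesis
    proof (cases "w = []")
      case True
      then show ?thesis using y h xw by (cases e) auto
    next
      case False
      then have "base (B.step l s) = base s" using h xw by (cases e) auto
      then show ?thesis using keep y by simp
    qed
  next
    case t
    define x' where "x' = (if e then psi x else x)"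
    have x': "x' \<in> carrier H" using psi_closed xw by (simp add: x'_def)
    have st: "B.step l s = (if e then psi x else phi x, push (K #> x', e) w)"
      using t xw by (cases e) (auto simp: x'_def)
    consider (empty) "w = []" | (pop) "w = [(K #> x', \<not> e)]" | (deep) "push (K #> x', e) w \<noteq> []" "w \<noteq> []" "last (push (K #> x', e) w) = last w"
    proof (cases w)
      case (Cons l' w')
      show ?thesis
      proof (cases "K #> x' = fst l' \<and> e \<noteq> snd l'")
        case True
        then have p: "push (K #> x', e) w = w'" "l' = (K #> x', \<not> e)"
          unfolding Cons by (auto simp: prod_eq_iff)
        show ?thesis
        proof (cases "w' = []")
          case True
          show ?thesis by (rule that(2)) (simp add: Cons True p(2))
        next
          case False
          show ?thesis by (rule that(3)) (simp_all add: p(1) False, simp_all add: Cons False)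
        qed
      next
        case False
        then have p: "push (K #> x', e) w = (K #> x', e) # w" unfolding Cons by auto
        show ?thesis by (rule that(3)) (simp_all only: p, simp_all add: Cons)
      qed
    qed (use that in blast)
    then show ?thesis
    proof cases
      case empty
      then have "y \<in> (if e then phi ` (K #> x') else K #> x')"
        using y st by (auto split: if_splits)
      then obtain k where k: "k \<in> K" "y = (if e then phi (k \<otimes> x') else k \<otimes> x')"
        unfolding r_coset_def by (cases e) auto
      then have "y = (if e then phi k else k) \<otimes> x"
        using K_carrier phi_mult phi_psi psi_closed xw by (simp add: x'_def)
      moreover have "(if e then phi k else k) \<in> S" using k KS by auto
      ultimately show ?thesis using empty xw by auto
    next
      case pop
      then have "y = (if e then psi x else phi x)" using y st by simp
      then have "y \<in> base s" using pop xw self_in_coset[OF x'] by (cases e) (auto simp: x'_def)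
      then show ?thesis by (rule keep)
    next
      case deep
      then have "base (B.step l s) = base s" using st xw by simp
      then show ?thesis using keep y by simp
    qed
  qed
qed

lemma base_word_ball:
  assumes KS: "K \<subseteq> S" "phi ` K \<subseteq> S" and SH: "S \<subseteq> carrier H"
    and u: "fst ` set u \<subseteq> insert None (Some ` S)"
  shows "base (B.act u (\<one>, [])) \<subseteq> word_ball H S (length u)"
  using u
proof (induction u)
  case Nil
  then show ?case using word_ball_one by simp
next
  case (Cons l u)
  have "valid u" using Cons.prems SH unfolding hnn_valid_def hnn_valid_letter_def
    by (fastforce split: option.splits)
  then have s: "B.act u (\<one>, []) \<in> carrier H \<times> stacks"
    by (rule B.act_closed) (simp add: stacks_def)
  show ?case
  proof
    fix y assume "y \<in> base (B.act (l # u) (\<one>, []))"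
    then obtain a z where a: "a \<in> S \<union> m_inv H ` S" "z \<in> base (B.act u (\<one>, []))" "y = a \<otimes> z"
      using base_step[OF KS SH _ s, of l y] Cons.prems by auto
    then have "a \<in> word_ball H S 1" "z \<in> word_ball H S (length u)"
      using word_ball_gen[OF SH, of a 0] Cons by auto
    then have "a \<otimes> z \<in> word_ball H S (1 + length u)" by (rule word_ball_mult[OF SH])
    then show "y \<in> word_ball H S (length (l # u))" using a by simp
  qed
qed

lemma foldr_cls:
  assumes "\<And>s. s \<in> set ws \<Longrightarrow> valid (u s) \<and> cls (u s) = s"
  shows "valid (concat (map u ws)) \<and> cls (concat (map u ws)) = foldr (\<otimes>\<^bsub>G\<^esub>) ws \<one>\<^bsub>G\<^esub>"
  using assms by (induction ws) (auto simp: G_one G_mult[symmetric])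

text \<open>For suitable generators the map from \<open>H\<close> to \<open>G\<close> is
  bilipschitz, so \<open>four_point_bilipschitz\<close> applies. The generators must include
  \<open>K\<close> and its image for \<open>base_step\<close>, hence the finiteness of
  \<open>K\<close>.\<close>

theorem hyperbolic_base:
  assumes fK: "finite K" and hyp: "hyperbolic_group G"
  shows "hyperbolic_group H \<and> (\<exists>S. finite S \<and> S \<subseteq> carrier H \<and> generate H S = carrier H)"
proof -
  obtain S \<delta> where S: "finite S" "S \<subseteq> carrier G" "generate G S = carrier G"
    and \<delta>: "\<forall>w\<in>carrier G. \<forall>x\<in>carrier G. \<forall>y\<in>carrier G. \<forall>z\<in>carrier G.
      gromov_product G S w x y \<ge> min (gromov_product G S w x z) (gromov_product G S w z y) - \<delta>"
    using hyp unfolding hyperbolic_group_def by blast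
  interpret W: word_metric G S using S by unfold_locales
  define S' where "S' = S \<union> m_inv G ` S"
  have S': "finite S'" "S' \<subseteq> carrier G" unfolding S'_def using S by auto
  obtain u where u: "\<And>s. s \<in> S' \<Longrightarrow> valid (u s) \<and> cls (u s) = s"
    using S'(2) G_carrier by (metis subsetD)
  \<comment> \<open>Every generator of \<open>G\<close> and its inverse get a fixed spelling;
    \<open>F\<close> holds the elements of \<open>H\<close> that occur in these spellings, so that
    \<open>base_word_ball\<close> applies to each concatenation of them.\<close>
  define F where "F = K \<union> phi ` K \<union> {h. \<exists>s\<in>S'. Some h \<in> fst ` set (u s)}"
  have "finite {h. \<exists>s\<in>S'. Some h \<in> fst ` set (u s)}"
  proof (rule finite_subset)
    show "{h. \<exists>s\<in>S'. Some h \<in> fst ` set (u s)} \<subseteq> the ` (\<Union>s\<in>S'. fst ` set (u s))" by force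
  qed (use S' in auto)
  then have F: "finite F" unfolding F_def using fK by auto
  have FH: "F \<subseteq> carrier H"
  proof -
    have "h \<in> carrier H" if "s \<in> S'" "Some h \<in> fst ` set (u s)" for h s
      using u[OF that(1)] that(2) unfolding hnn_valid_def hnn_valid_letter_def by force
    then show ?thesis unfolding F_def using K_carrier phi_closed by auto
  qed
  have KF: "K \<subseteq> F" "phi ` K \<subseteq> F" unfolding F_def by auto
  define L where "L = (\<Sum>s\<in>S'. length (u s))"
  have L: "length (u s) \<le> L" if "s \<in> S'" for s
    unfolding L_def using that S' by (intro member_le_sum) auto
  have ball: "h \<in> word_ball H F (L * W.wl (\<iota> h))" if h: "h \<in> carrier H" for h
  proof -
    obtain ws where ws: "foldr (\<otimes>\<^bsub>G\<^esub>) ws \<one>\<^bsub>G\<^esub> = \<iota> h" "length ws \<le> W.wl (\<iota> h)" "set ws \<subseteq> S'"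
      using W.wl_ball[of "\<iota> h"] h unfolding word_ball_def S'_def by auto
    let ?v = "concat (map u ws)"
    have v: "valid ?v" "cls ?v = \<iota> h" using foldr_cls[of ws u] u ws by auto
    \<comment> \<open>Both words represent the image of \<open>h\<close>, so both lead to
      \<open>(h, [])\<close>, whose \<open>base\<close> is \<open>{h}\<close>: the number of letters
      bounds the length of \<open>h\<close>.\<close>
    have "B.act ?v (\<one>, []) = B.act [(Some h, False)] (\<one>, [])"
      using v h by (intro B.act_rel) (auto simp: cls_eq_iff[symmetric] stacks_def)
    then have "h \<in> base (B.act ?v (\<one>, []))" using h by simp
    moreover have "fst ` set ?v \<subseteq> insert None (Some ` F)"
    proof
      fix a assume "a \<in> fst ` set ?v"
      then obtain s where "s \<in> S'" "a \<in> fst ` set (u s)" using ws(3) by auto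
      then show "a \<in> insert None (Some ` F)" unfolding F_def by (cases a) auto
    qed
    ultimately have "h \<in> word_ball H F (length ?v)" using base_word_ball[OF KF FH] by blast
    moreover have "length ?v \<le> L * length ws"
      using ws(3) by (induction ws) (auto intro!: add_mono L)
    ultimately show ?thesis using word_ball_mono ws(2) by (meson le_trans mult_le_mono2 subsetD)
  qed
  have gen: "generate H F = carrier H"
    using ball word_ball_carrier[OF FH] unfolding generate_eq_word_balls[OF FH] by blast
  interpret V: word_metric H F using F FH gen by unfold_locales
  define \<Lambda> where "\<Lambda> = (\<Sum>s\<in>F. W.wl (\<iota> s))"
  have \<Lambda>: "W.wl (\<iota> s) \<le> \<Lambda>" if "s \<in> F \<union> m_inv H ` F" for s
  proof -
    have "W.wl (\<iota> s) \<le> \<Lambda>" if "s \<in> F" for s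
      unfolding \<Lambda>_def using that F by (intro member_le_sum) auto
    then show ?thesis using that FH by (auto simp: iota_inv W.wl_inv subset_iff)
  qed
  have up: "W.wl (\<iota> h) \<le> \<Lambda> * V.wl h" if h: "h \<in> carrier H" for h
  proof -
    obtain ws where ws: "h = foldr (\<otimes>) ws \<one>" "length ws \<le> V.wl h" "set ws \<subseteq> F \<union> m_inv H ` F"
      using V.wl_ball[OF h] unfolding word_ball_def by auto
    have "W.wl (\<iota> (foldr (\<otimes>) ws \<one>)) \<le> \<Lambda> * length ws"
      using ws(3)
    proof (induction ws)
      case Nil
      then show ?case by (simp add: iota_one W.wl_one)
    next
      case (Cons a ws)
      have c: "a \<in> carrier H" "foldr (\<otimes>) ws \<one> \<in> carrier H"
        using Cons.prems symmetric_closed[OF FH] foldr_mult_closed[of ws] by auto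
      have "W.wl (\<iota> (a \<otimes> foldr (\<otimes>) ws \<one>)) \<le> W.wl (\<iota> a) + W.wl (\<iota> (foldr (\<otimes>) ws \<one>))"
        using W.wl_mult[of "\<iota> a" "\<iota> (foldr (\<otimes>) ws \<one>)"] c by (simp add: iota_mult)
      also have "\<dots> \<le> \<Lambda> + \<Lambda> * length ws" using Cons \<Lambda>[of a] by (intro add_mono) auto
      finally show ?case by simp
    qed
    then show ?thesis using ws(1,2) by (meson le_trans mult_le_mono2)
  qed
  have dist: "W.wd (\<iota> x) (\<iota> y) = W.wl (\<iota> (inv x \<otimes> y))" if "x \<in> carrier H" "y \<in> carrier H" for x y
    unfolding word_dist_def using that by (simp add: iota_inv[symmetric] iota_mult)
  have "\<exists>\<delta>'. four_point (carrier H) V.wd \<delta>'"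
  proof (rule four_point_bilipschitz[OF W.graph_metric_axioms V.graph_metric_axioms iffD2[OF W.four_point_iff \<delta>],
        of "\<lambda>h. \<iota> h" \<Lambda> L])
    fix x y assume xy: "x \<in> carrier H" "y \<in> carrier H"
    show "W.wd (\<iota> x) (\<iota> y) \<le> \<Lambda> * V.wd x y"
      using up[of "inv x \<otimes> y"] xy by (simp add: dist word_dist_def[of H])
    show "V.wd x y \<le> L * W.wd (\<iota> x) (\<iota> y)"
      using ball[of "inv x \<otimes> y"] V.wl_le_iff xy by (simp add: dist word_dist_def[of H])
  qed simp
  then have "\<exists>\<delta>::real. \<forall>w\<in>carrier H. \<forall>x\<in>carrier H. \<forall>y\<in>carrier H. \<forall>z\<in>carrier H.
     gromov_product H F w x y \<ge> min (gromov_product H F w x z) (gromov_product H F w z y) - \<delta>"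
    using V.four_point_iff by blast
  then show ?thesis unfolding hyperbolic_group_def using F FH gen is_group by blast
qed

end

section \<open>Subgroups of finite index\<close>

lemma extend_to_permutation:
  assumes "inj_on f A" "A \<subseteq> B" "f ` A \<subseteq> B" "finite B"
  shows "\<exists>p. p permutes B \<and> (\<forall>a\<in>A. p a = f a)"
proof -
  have "card (B - A) = card (B - f ` A)"
    using assms by (simp add: card_Diff_subset card_image finite_subset)
  then obtain g where g: "bij_betw g (B - A) (B - f ` A)"
    using assms finite_same_card_bij[of "B - A" "B - f ` A"] by blast
  define p where "p x = (if x \<in> A then f x else if x \<in> B then g x else x)" for x
  have "bij_betw p A (f ` A)"
    using assms(1) by (intro bij_betw_imageI) (auto simp: p_def inj_on_def)
  moreover have "bij_betw p (B - A) (B - f ` A)"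
    using bij_betw_cong[of "B - A" p g] g by (simp add: p_def)
  ultimately have "bij_betw p (A \<union> (B - A)) (f ` A \<union> (B - f ` A))"
    by (rule bij_betw_combine) auto
  then have "bij_betw p B B" using assms by (simp add: Un_absorb1)
  then have "p permutes B" using assms(2) by (intro bij_imp_permutes) (auto simp: p_def)
  then show ?thesis by (auto simp: p_def)
qed

text \<open>For bijections \<open>\<tau> c\<close>, the action of the free group on the letters that
  sends each letter \<open>c\<close> to \<open>\<tau> c\<close>; the first letter of the word acts
  last.\<close>

definition ev :: "('c \<Rightarrow> 'p \<Rightarrow> 'p) \<Rightarrow> ('c \<times> bool) list \<Rightarrow> 'p \<Rightarrow> 'p" where
  "ev \<tau> w p = foldr (\<lambda>l. if snd l then inv_into UNIV (\<tau> (fst l)) else \<tau> (fst l)) w p"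

lemma ev_simps [simp]:
  "ev \<tau> [] p = p" "ev \<tau> (l # w) p = (if snd l then inv_into UNIV (\<tau> (fst l)) else \<tau> (fst l)) (ev \<tau> w p)"
  unfolding ev_def by auto

lemma ev_map: "ev \<tau> (map (map_prod \<nu> id) w) p = ev (\<tau> \<circ> \<nu>) w p"
  by (induction w) auto

lemma ev_push:
  assumes "bij (\<tau> c)"
  shows "ev \<tau> (push (c, e) w) p = (if e then inv_into UNIV (\<tau> c) else \<tau> c) (ev \<tau> w p)"
  using bij_is_surj[OF assms] bij_is_inj[OF assms]
  by (cases w) (auto simp: surj_f_inv_f inv_f_f)

lemma reduced_nth: "reduced w \<Longrightarrow> Suc i < length w \<Longrightarrow> fst (w ! i) = fst (w ! Suc i) \<Longrightarrow> snd (w ! i) = snd (w ! Suc i)"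
proof (induction w arbitrary: i rule: reduced.induct)
  case (1 l l' w)
  then show ?case by (cases i) auto
qed auto

lemma reduced_map: "inj_on \<nu> (fst ` set w) \<Longrightarrow> reduced w \<Longrightarrow> reduced (map (map_prod \<nu> id) w)"
  by (induction w rule: reduced.induct) (auto simp: inj_on_def)

text \<open>The \<open>j\<close>-th letter of the word is made to send \<open>j + 1\<close> to \<open>j\<close>. That \<open>w\<close> is reduced says
  that these prescriptions define partial injections, which extend to permutations.\<close>

theorem reduced_word_acts_nontrivially:
  fixes w :: "('c \<times> bool) list"
  assumes "reduced w"
  shows "\<exists>\<tau>. (\<forall>c. \<tau> c permutes {..length w}) \<and> ev \<tau> w (length w) = 0"
proof -
  define m where "m = length w"
  \<comment> \<open>A letter \<open>(c, False)\<close> at \<open>j\<close> asks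
    \<open>\<tau> c\<close> to send \<open>j + 1\<close> to \<open>j\<close>; a letter
    \<open>(c, True)\<close> asks this of the inverse, so \<open>\<tau> c\<close> must send
    \<open>j\<close> to \<open>j + 1\<close>. \<open>A c\<close> collects the arguments concerned.
    Two demands can clash, in argument or in value, only at neighbouring letters that
    cancel.\<close>
  define A where "A c = {Suc j | j. j < m \<and> w ! j = (c, False)} \<union> {j. j < m \<and> w ! j = (c, True)}" for c
  define f where "f c i = (if i < m \<and> w ! i = (c, True) then Suc i else i - 1)" for c i
  have adj: False if "Suc i < m" "w ! i = (c, e)" "w ! Suc i = (c, \<not> e)" for i c e
    using reduced_nth[OF assms, of i] that by (simp add: m_def)
  have down: "f c (Suc j) = j" if "j < m" "w ! j = (c, False)" for c j
    using adj[of j c False] that unfolding f_def by auto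
  have up: "f c j = Suc j" if "j < m" "w ! j = (c, True)" for c j
    using that unfolding f_def by auto
  have inj: "inj_on (f c) (A c)" for c
  proof (rule inj_onI)
    fix x y assume "x \<in> A c" "y \<in> A c" "f c x = f c y"
    moreover have False if "Suc j < m" "w ! Suc j = (c, False)" "w ! j = (c, True)" for j
      using adj[of j c True] that by auto
    ultimately show "x = y" unfolding A_def using down up by auto
  qed
  have "\<exists>p. p permutes {..m} \<and> (\<forall>a\<in>A c. p a = f c a)" for c
  proof (rule extend_to_permutation[OF inj])
    show "A c \<subseteq> {..m}" unfolding A_def by auto
    show "f c ` A c \<subseteq> {..m}" unfolding A_def using down up by auto
  qed simp
  then obtain \<tau> where \<tau>: "\<And>c. \<tau> c permutes {..m}" "\<And>c a. a \<in> A c \<Longrightarrow> \<tau> c a = f c a" by metis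
  \<comment> \<open>The letters act from the right, each lowering the value by 1, so induction runs
    down over the suffixes.\<close>
  have "ev \<tau> (drop j w) m = j" if "j \<le> m" for j
    using that
  proof (induction j rule: inc_induct)
    case base
    then show ?case by (simp add: m_def)
  next
    case (step j)
    obtain c e where l: "w ! j = (c, e)" by fastforce
    have "ev \<tau> (drop j w) m = (if e then inv_into UNIV (\<tau> c) else \<tau> c) (Suc j)"
      using step l by (simp add: Cons_nth_drop_Suc[symmetric] m_def)
    also have "\<dots> = j"
    proof (cases e)
      case True
      then have "\<tau> c j = Suc j" using \<tau>(2)[of j c] up[of j c] l step by (auto simp: A_def)
      then show ?thesis using True permutes_inverses(2)[OF \<tau>(1), of c j] by simp
    next
      case False
      then have "\<tau> c (Suc j) = j" using \<tau>(2)[of "Suc j" c] down[of j c] l step by (auto simp: A_def)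
      then show ?thesis using False by simp
    qed
    finally show ?case .
  qed
  from this[of 0] show ?thesis using \<tau>(1) m_def by auto
qed

context group
begin

text \<open>There are no more cosets than values of \<open>f\<close>, since equal values force equal
  cosets.\<close>

lemma finite_rcosets_if:
  assumes N: "subgroup N G" and fin: "finite (f ` carrier G)"
    and sep: "\<And>x y. x \<in> carrier G \<Longrightarrow> y \<in> carrier G \<Longrightarrow> f x = f y \<Longrightarrow> x \<otimes> inv y \<in> N"
  shows "finite (rcosets N)"
proof -
  have "N #> x = N #> inv_into (carrier G) f (f x)" if x: "x \<in> carrier G" for x
  proof -
    define y where "y = inv_into (carrier G) f (f x)"
    have y: "y \<in> carrier G" "f x = f y"
      using x unfolding y_def by (auto simp: inv_into_into f_inv_into_f)
    have "x = (x \<otimes> inv y) \<otimes> y" using x y by (simp add: m_assoc)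
    then have "x \<in> N #> y" using sep[OF x y] unfolding r_coset_def by blast
    then show ?thesis using repr_independence N y y_def by metis
  qed
  then have "rcosets N \<subseteq> (\<lambda>z. N #> inv_into (carrier G) f z) ` f ` carrier G"
    unfolding RCOSETS_def by auto
  then show ?thesis using fin finite_subset by blast
qed

lemma hom_eq_on_generators:
  assumes "group L" "\<theta> \<in> hom G L" "\<eta> \<in> hom G L" "F \<subseteq> carrier G" "\<And>x. x \<in> F \<Longrightarrow> \<theta> x = \<eta> x"
    and "x \<in> generate G F"
  shows "\<theta> x = \<eta> x"
proof -
  interpret \<theta>: group_hom G L \<theta>
    using assms(2) by (intro group_hom.intro is_group assms(1) group_hom_axioms.intro)
  interpret \<eta>: group_hom G L \<eta>
    using assms(3) by (intro group_hom.intro is_group assms(1) group_hom_axioms.intro)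
  from assms(6) show ?thesis
  proof (induction rule: generate.induct)
    case (eng a b)
    then have "a \<in> carrier G" "b \<in> carrier G" using generate_in_carrier assms(4) by blast+
    then show ?case using eng by simp
  next
    case (inv h)
    then show ?case using assms(4,5) by auto
  qed (use assms(5) in auto)
qed

text \<open>The common kernel of all homomorphisms to the finite quotient \<open>G / M\<close> is invariant under
  every automorphism, and it has finite index as a finitely generated group has only finitely
  many homomorphisms to a finite group.\<close>

lemma invariant_finite_index:
  assumes F: "finite F" "F \<subseteq> carrier G" "generate G F = carrier G"
    and M: "M \<lhd> G" "finite (rcosets M)" and phi: "phi \<in> iso G G"
  shows "\<exists>N. N \<lhd> G \<and> finite (rcosets N) \<and> phi ` N = N \<and> N \<subseteq> M"
proof -
  let ?Q = "G Mod M"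
  interpret M: normal M G by fact
  have Q: "group ?Q" by (rule M.factorgroup_is_group)
  interpret Qg: group ?Q by (rule Q)
  have fQ: "finite (carrier ?Q)" using M(2) unfolding FactGroup_def by simp
  define N where "N = {h \<in> carrier G. \<forall>\<theta>\<in>hom G ?Q. \<theta> h = \<one>\<^bsub>?Q\<^esub>}"
  have gh: "group_hom G ?Q \<theta>" if "\<theta> \<in> hom G ?Q" for \<theta>
    using that by (intro group_hom.intro is_group Q group_hom_axioms.intro)
  have Nsub: "subgroup N G"
  proof
    show "N \<subseteq> carrier G" unfolding N_def by auto
    show "\<one> \<in> N" unfolding N_def using group_hom.hom_one[OF gh] by auto
    fix x assume x: "x \<in> N"
    then have xG: "x \<in> carrier G" and x1: "\<And>\<theta>. \<theta> \<in> hom G ?Q \<Longrightarrow> \<theta> x = \<one>\<^bsub>?Q\<^esub>" unfolding N_def by auto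
    have "\<theta> (inv x) = \<one>\<^bsub>?Q\<^esub>" if \<theta>: "\<theta> \<in> hom G ?Q" for \<theta>
      by (simp only: group_hom.hom_inv[OF gh[OF \<theta>] xG] x1[OF \<theta>] Qg.inv_one)
    then show "inv x \<in> N" unfolding N_def using xG by blast
    fix y assume y: "y \<in> N"
    then have yG: "y \<in> carrier G" and y1: "\<And>\<theta>. \<theta> \<in> hom G ?Q \<Longrightarrow> \<theta> y = \<one>\<^bsub>?Q\<^esub>" unfolding N_def by auto
    have "\<theta> (x \<otimes> y) = \<one>\<^bsub>?Q\<^esub>" if \<theta>: "\<theta> \<in> hom G ?Q" for \<theta>
      by (simp only: group_hom.hom_mult[OF gh[OF \<theta>] xG yG] x1[OF \<theta>] y1[OF \<theta>] Qg.l_one[OF Qg.one_closed])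
    then show "x \<otimes> y \<in> N" unfolding N_def using xG yG by blast
  qed
  have "N \<lhd> G"
    unfolding normal_inv_iff
  proof (intro conjI ballI Nsub)
    fix x h assume x: "x \<in> carrier G" and h: "h \<in> N"
    have "\<theta> (x \<otimes> h \<otimes> inv x) = \<one>\<^bsub>?Q\<^esub>" if \<theta>: "\<theta> \<in> hom G ?Q" for \<theta>
    proof -
      interpret \<theta>: group_hom G ?Q \<theta> by (rule gh[OF \<theta>])
      have "\<theta> h = \<one>\<^bsub>?Q\<^esub>" "h \<in> carrier G" using h \<theta> unfolding N_def by auto
      then have "\<theta> (x \<otimes> h \<otimes> inv x) = \<theta> x \<otimes>\<^bsub>?Q\<^esub> \<one>\<^bsub>?Q\<^esub> \<otimes>\<^bsub>?Q\<^esub> inv\<^bsub>?Q\<^esub> \<theta> x"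
        using x by (simp del: one_FactGroup mult_FactGroup)
      also have "\<dots> = \<one>\<^bsub>?Q\<^esub>"
        using Qg.r_one[OF \<theta>.hom_closed[OF x]] Qg.r_inv[OF \<theta>.hom_closed[OF x]] by simp
      finally show ?thesis .
    qed
    then show "x \<otimes> h \<otimes> inv x \<in> N" using x h unfolding N_def by auto
  qed
  moreover have "finite (rcosets N)"
  proof (rule finite_rcosets_if[OF Nsub])
    \<comment> \<open>Off the carrier a homomorphism is an arbitrary function, so only the
      restrictions can form a finite set.\<close>
    define \<Theta> where "\<Theta> = (\<lambda>\<theta>. restrict \<theta> (carrier G)) ` hom G ?Q"
    have "inj_on (\<lambda>\<theta>. restrict \<theta> F) \<Theta>"
    proof (rule inj_onI)
      fix a b assume "a \<in> \<Theta>" "b \<in> \<Theta>" and eq: "restrict a F = restrict b F"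
      then obtain \<theta> \<eta> where h: "\<theta> \<in> hom G ?Q" "\<eta> \<in> hom G ?Q" "a = restrict \<theta> (carrier G)" "b = restrict \<eta> (carrier G)"
        unfolding \<Theta>_def by blast
      have "\<theta> x = \<eta> x" if "x \<in> F" for x
        using fun_cong[OF eq, of x] that F(2) h(3,4) by (auto simp: subset_iff)
      then have "\<theta> x = \<eta> x" if "x \<in> carrier G" for x
        using hom_eq_on_generators[OF Q h(1,2) F(2)] F(3) that by blast
      then show "a = b" unfolding h(3,4) by (rule restrict_ext)
    qed
    moreover have "(\<lambda>\<theta>. restrict \<theta> F) ` \<Theta> \<subseteq> F \<rightarrow>\<^sub>E carrier ?Q"
    proof -
      have "\<theta> x \<in> carrier ?Q" if "\<theta> \<in> hom G ?Q" "x \<in> F" for \<theta> x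
        using hom_in_carrier[OF that(1)] that(2) F(2) by blast
      then show ?thesis unfolding \<Theta>_def using F(2) by (auto simp: PiE_def Pi_def simp del: carrier_FactGroup)
    qed
    moreover have "finite (F \<rightarrow>\<^sub>E carrier ?Q)" using F(1) fQ by (intro finite_PiE) auto
    ultimately have "finite \<Theta>" by (meson finite_imageD finite_subset)
    then have "finite (\<Theta> \<rightarrow>\<^sub>E carrier ?Q)" using fQ by (intro finite_PiE) auto
    moreover have "(\<lambda>x. restrict (\<lambda>\<theta>. \<theta> x) \<Theta>) ` carrier G \<subseteq> \<Theta> \<rightarrow>\<^sub>E carrier ?Q"
    proof -
      have "\<theta> x \<in> carrier ?Q" if "\<theta> \<in> hom G ?Q" "x \<in> carrier G" for \<theta> x
        using hom_in_carrier[OF that] .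
      then show ?thesis unfolding \<Theta>_def by (auto simp: PiE_def Pi_def simp del: carrier_FactGroup)
    qed
    ultimately show "finite ((\<lambda>x. restrict (\<lambda>\<theta>. \<theta> x) \<Theta>) ` carrier G)" by (rule rev_finite_subset)
    fix x y assume xy: "x \<in> carrier G" "y \<in> carrier G"
      and eq: "restrict (\<lambda>\<theta>. \<theta> x) \<Theta> = restrict (\<lambda>\<theta>. \<theta> y) \<Theta>"
    have "\<theta> (x \<otimes> inv y) = \<one>\<^bsub>?Q\<^esub>" if \<theta>: "\<theta> \<in> hom G ?Q" for \<theta>
    proof -
      interpret \<theta>: group_hom G ?Q \<theta> by (rule gh[OF \<theta>])
      have "restrict \<theta> (carrier G) \<in> \<Theta>" using \<theta> \<Theta>_def by blast
      then have "\<theta> x = \<theta> y" using fun_cong[OF eq, of "restrict \<theta> (carrier G)"] xy by simp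
      then have "\<theta> (x \<otimes> inv y) = \<theta> y \<otimes>\<^bsub>?Q\<^esub> inv\<^bsub>?Q\<^esub> \<theta> y"
        using xy by (simp del: one_FactGroup mult_FactGroup)
      then show ?thesis using Qg.r_inv[OF \<theta>.hom_closed[OF xy(2)]] by simp
    qed
    then show "x \<otimes> inv y \<in> N" unfolding N_def using xy by auto
  qed
  moreover have "phi ` N = N"
  proof -
    have sub: "\<psi> ` N \<subseteq> N" if \<psi>: "\<psi> \<in> iso G G" for \<psi>
    proof
      fix y assume "y \<in> \<psi> ` N"
      then obtain x where x: "x \<in> N" "y = \<psi> x" by blast
      have \<psi>h: "\<psi> \<in> hom G G" using \<psi> by (simp add: iso_def)
      have "\<theta> (\<psi> x) = \<one>\<^bsub>?Q\<^esub>" if "\<theta> \<in> hom G ?Q" for \<theta>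
      proof -
        have "(\<theta> \<circ> \<psi>) x = \<one>\<^bsub>?Q\<^esub>" using x(1) Group.hom_compose[OF \<psi>h that] unfolding N_def by blast
        then show ?thesis by simp
      qed
      moreover have "\<psi> x \<in> carrier G" using hom_in_carrier[OF \<psi>h] x(1) unfolding N_def by blast
      ultimately show "y \<in> N" unfolding N_def x(2) by blast
    qed
    \<comment> \<open>The inclusion for the inverse automorphism upgrades invariance to
      equality.\<close>
    have "inv_into (carrier G) phi \<in> iso G G" using iso_set_sym[OF phi] .
    then have "inv_into (carrier G) phi ` N \<subseteq> N" by (rule sub)
    moreover have "phi (inv_into (carrier G) phi x) = x" if "x \<in> N" for x
      using that phi f_inv_into_f[of x phi "carrier G"] unfolding N_def iso_def bij_betw_def by auto
    ultimately have "N \<subseteq> phi ` N" by (metis image_subset_iff imageI subsetI)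
    then show ?thesis using sub[OF phi] by blast
  qed
  moreover have "N \<subseteq> M"
  proof
    fix h assume h: "h \<in> N"
    \<comment> \<open>The quotient map is one of the homomorphisms whose kernels are
      intersected.\<close>
    have "(\<lambda>a. M #> a) \<in> hom G ?Q" by (rule M.r_coset_hom_Mod)
    then have "M #> h = M" using h unfolding N_def by auto
    moreover have "h \<in> carrier G" using h N_def by blast
    ultimately show "h \<in> M" by (rule coset_join1[OF _ _ M.subgroup_axioms])
  qed
  ultimately show ?thesis by blast
qed

text \<open>Each further element to avoid costs one intersection, which preserves normality, finite
  index and, as \<open>phi\<close> is injective, invariance.\<close>

lemma invariant_finite_index_avoiding:
  assumes F: "finite F" "F \<subseteq> carrier G" "generate G F = carrier G"
    and rf: "residually_finite G" and phi: "phi \<in> iso G G"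
    and E: "finite E" "E \<subseteq> carrier G - {\<one>}"
  shows "\<exists>N. N \<lhd> G \<and> finite (rcosets N) \<and> phi ` N = N \<and> N \<inter> E = {}"
  using E
proof (induction E rule: finite_induct)
  case empty
  have "carrier G \<lhd> G" unfolding normal_inv_iff using subgroup_self by auto
  moreover have "rcosets carrier G \<subseteq> {carrier G}"
    unfolding RCOSETS_def using coset_join2[OF _ subgroup_self] by auto
  moreover have "phi ` carrier G = carrier G" using phi by (simp add: iso_def bij_betw_def)
  ultimately show ?case using finite_subset by blast
next
  case (insert x E)
  then obtain N where N: "N \<lhd> G" "finite (rcosets N)" "phi ` N = N" "N \<inter> E = {}" by auto
  obtain M where M: "M \<lhd> G" "finite (rcosets M)" "x \<notin> M"
    using rf insert.prems unfolding residually_finite_def by auto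
  obtain L where L: "L \<lhd> G" "finite (rcosets L)" "phi ` L = L" "x \<notin> L"
    using invariant_finite_index[OF F M(1,2) phi] M(3) by blast
  have sub: "subgroup N G" "subgroup L G" using N L normal_imp_subgroup by blast+
  then have sub': "subgroup (N \<inter> L) G" by (rule subgroups_Inter_pair)
  have carr: "N \<subseteq> carrier G" "L \<subseteq> carrier G" using sub subgroup.subset by blast+
  have "N \<inter> L \<lhd> G" using N(1) L(1) sub' unfolding normal_inv_iff by auto
  moreover have "finite (rcosets (N \<inter> L))"
  proof (rule finite_rcosets_if[OF sub', of "\<lambda>x. (N #> x, L #> x)"])
    have "(\<lambda>x. (N #> x, L #> x)) ` carrier G \<subseteq> (rcosets N) \<times> (rcosets L)"
      using rcosetsI carr by auto
    then show "finite ((\<lambda>x. (N #> x, L #> x)) ` carrier G)"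
      by (rule finite_subset[OF _ finite_cartesian_product[OF N(2) L(2)]])
    fix a b assume ab: "a \<in> carrier G" "b \<in> carrier G" "(N #> a, L #> a) = (N #> b, L #> b)"
    have "a \<otimes> inv b \<in> U" if "subgroup U G" "U #> a = U #> b" for U
    proof -
      have "a \<in> U #> b" using that rcos_self[OF ab(1)] by blast
      then obtain u where "u \<in> U" "a = u \<otimes> b" unfolding r_coset_def by blast
      moreover then have "u \<in> carrier G" using subgroup.subset[OF that(1)] by blast
      ultimately show ?thesis using ab by (simp add: m_assoc)
    qed
    then show "a \<otimes> inv b \<in> N \<inter> L" using ab sub by blast
  qed
  moreover have "phi ` (N \<inter> L) = N \<inter> L"
  proof -
    have "inj_on phi (carrier G)" using phi by (simp add: iso_def bij_betw_def)
    then have "phi ` (N \<inter> L) = phi ` N \<inter> phi ` L" using inj_on_image_Int carr by blast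
    then show ?thesis using N L by simp
  qed
  ultimately show ?case using N(4) L(4) by blast
qed

end

lemma (in hnn_action) kernel_finite_index:
  assumes "finite M"
  shows "{g \<in> carrier G. \<forall>s\<in>M. gact g s = s} \<lhd> G"
    and "finite (rcosets\<^bsub>G\<^esub> {g \<in> carrier G. \<forall>s\<in>M. gact g s = s})"
proof -
  let ?N = "{g \<in> carrier G. \<forall>s\<in>M. gact g s = s}"
  have gi: "gact (inv\<^bsub>G\<^esub> g) s = s" if "g \<in> ?N" "s \<in> M" for g s
    using that gact_inv[of g s] by auto
  have sub: "subgroup ?N G"
  proof
    show "?N \<subseteq> carrier G" by auto
    show "\<one>\<^bsub>G\<^esub> \<in> ?N" using gact_one by auto
    show "x \<otimes>\<^bsub>G\<^esub> y \<in> ?N" if "x \<in> ?N" "y \<in> ?N" for x y using that by (auto simp: gact_mult)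
    show "inv\<^bsub>G\<^esub> x \<in> ?N" if "x \<in> ?N" for x using that gi by auto
  qed
  show "?N \<lhd> G"
    unfolding G.normal_inv_iff
  proof (intro conjI ballI sub)
    fix x h assume x: "x \<in> carrier G" and h: "h \<in> ?N"
    have "gact (x \<otimes>\<^bsub>G\<^esub> h \<otimes>\<^bsub>G\<^esub> inv\<^bsub>G\<^esub> x) s = s" if s: "s \<in> M" for s
    proof -
      have c: "gact (inv\<^bsub>G\<^esub> x) s \<in> M" using gact_closed x s by auto
      have "gact (x \<otimes>\<^bsub>G\<^esub> h \<otimes>\<^bsub>G\<^esub> inv\<^bsub>G\<^esub> x) s = gact x (gact h (gact (inv\<^bsub>G\<^esub> x) s))"
        using x h s c by (simp add: gact_mult)
      also have "\<dots> = gact x (gact (inv\<^bsub>G\<^esub> x) s)" using h c by simp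
      also have "\<dots> = s" using gact_inv[of "inv\<^bsub>G\<^esub> x" s] x s by simp
      finally show ?thesis .
    qed
    then show "x \<otimes>\<^bsub>G\<^esub> h \<otimes>\<^bsub>G\<^esub> inv\<^bsub>G\<^esub> x \<in> ?N" using x h by auto
  qed
  show "finite (rcosets\<^bsub>G\<^esub> ?N)"
  proof (rule G.finite_rcosets_if[OF sub, of "\<lambda>g. restrict (gact g) M"])
    have "(\<lambda>g. restrict (gact g) M) ` carrier G \<subseteq> M \<rightarrow>\<^sub>E M" using gact_closed by auto
    then show "finite ((\<lambda>g. restrict (gact g) M) ` carrier G)"
      using finite_PiE[of M "\<lambda>_. M"] assms finite_subset by blast
    fix x y assume xy: "x \<in> carrier G" "y \<in> carrier G" "restrict (gact x) M = restrict (gact y) M"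
    have "gact (x \<otimes>\<^bsub>G\<^esub> inv\<^bsub>G\<^esub> y) s = s" if s: "s \<in> M" for s
    proof -
      have c: "gact (inv\<^bsub>G\<^esub> y) s \<in> M" using gact_closed xy s by auto
      have "gact (x \<otimes>\<^bsub>G\<^esub> inv\<^bsub>G\<^esub> y) s = gact x (gact (inv\<^bsub>G\<^esub> y) s)" using xy s by (simp add: gact_mult)
      also have "\<dots> = gact y (gact (inv\<^bsub>G\<^esub> y) s)" using fun_cong[OF xy(3)] c by (metis restrict_apply')
      also have "\<dots> = s" using gact_inv[of "inv\<^bsub>G\<^esub> y" s] xy s by simp
      finally show ?thesis .
    qed
    then show "x \<otimes>\<^bsub>G\<^esub> inv\<^bsub>G\<^esub> y \<in> ?N" using xy by auto
  qed
qed

section \<open>Residual finiteness of HNN extensions\<close>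

context hnn
begin

text \<open>\<open>code w x\<close> is the element of \<open>G\<close> that moves \<open>(\<one>, [])\<close> to \<open>(x, w)\<close>.\<close>

primrec code :: "('a set \<times> bool) list \<Rightarrow> 'a \<Rightarrow> 'a hnn_letter list set" where
  "code [] x = \<iota> x"
| "code (l # w) x = (let y = SOME y. y \<in> fst l in
     if snd l then \<iota> (x \<otimes> inv y) \<otimes>\<^bsub>G\<^esub> (inv\<^bsub>G\<^esub> T \<otimes>\<^bsub>G\<^esub> code w (phi y))
     else \<iota> (x \<otimes> inv (phi y)) \<otimes>\<^bsub>G\<^esub> (T \<otimes>\<^bsub>G\<^esub> code w y))"

lemma some_in_rcoset:
  assumes "c \<in> rcosets K" shows "(SOME y. y \<in> c) \<in> c" "(SOME y. y \<in> c) \<in> carrier H"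
proof -
  have "c \<noteq> {}" using subgroup.rcosets_non_empty[OF K assms] .
  then show 1: "(SOME y. y \<in> c) \<in> c" by (rule some_in_eq[THEN iffD2])
  then show "(SOME y. y \<in> c) \<in> carrier H"
    using subgroup.rcosets_carrier[OF K is_group assms] by blast
qed

lemma code_closed: "fst ` set w \<subseteq> rcosets K \<Longrightarrow> x \<in> carrier H \<Longrightarrow> code w x \<in> carrier G"
proof (induction w arbitrary: x)
  case (Cons l w)
  have "(SOME y. y \<in> fst l) \<in> carrier H" using some_in_rcoset(2) Cons.prems(1) by auto
  then show ?case using Cons phi_closed by (auto simp: Let_def)
qed simp

lemma code_mult:
  "fst ` set w \<subseteq> rcosets K \<Longrightarrow> h \<in> carrier H \<Longrightarrow> x \<in> carrier H \<Longrightarrow> code w (h \<otimes> x) = \<iota> h \<otimes>\<^bsub>G\<^esub> code w x"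
proof (cases w)
  case (Cons l v)
  assume a: "fst ` set w \<subseteq> rcosets K" "h \<in> carrier H" "x \<in> carrier H"
  define y where "y = (SOME y. y \<in> fst l)"
  have y: "y \<in> carrier H" unfolding y_def using some_in_rcoset(2) a(1) Cons by auto
  have v: "fst ` set v \<subseteq> rcosets K" using a(1) Cons by auto
  have c: "code v y \<in> carrier G" "code v (phi y) \<in> carrier G" using code_closed[OF v] y phi_closed by auto
  have *: "\<iota> (h \<otimes> x \<otimes> inv z) \<otimes>\<^bsub>G\<^esub> d = \<iota> h \<otimes>\<^bsub>G\<^esub> (\<iota> (x \<otimes> inv z) \<otimes>\<^bsub>G\<^esub> d)"
    if "z \<in> carrier H" "d \<in> carrier G" for z d
    using a that by (simp add: m_assoc G.m_assoc[symmetric] iota_mult)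
  show ?thesis
    unfolding Cons code.simps Let_def y_def[symmetric] using *[of y] *[of "phi y"] y c phi_closed by auto
qed (simp add: iota_mult)

lemma in_coset_K: "y \<in> K #> x \<Longrightarrow> \<exists>k\<in>K. y = k \<otimes> x"
  unfolding r_coset_def by auto

text \<open>The chosen representative is \<open>k \<otimes> x\<close> for some \<open>k\<close> in
  \<open>K\<close>; the relation moves \<open>phi (inv k)\<close> through t, where it cancels
  \<open>k\<close>. So \<open>code\<close> does not depend on the choice.\<close>

lemma code_push_T:
  assumes w: "fst ` set w \<subseteq> rcosets K" and x: "x \<in> carrier H"
  shows "code ((K #> x, False) # w) (phi x) = T \<otimes>\<^bsub>G\<^esub> code w x"
proof -
  define y where "y = (SOME y. y \<in> K #> x)"
  obtain k where k: "k \<in> K" "y = k \<otimes> x"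
    using in_coset_K some_in_rcoset(1)[OF coset_in_rcosets[OF x]] y_def by blast
  have k': "inv k \<in> K" "k \<in> carrier H" using k subgroup.m_inv_closed[OF K] K_carrier by auto
  have c: "code w x \<in> carrier G" using code_closed[OF w x] .
  have "x \<otimes> inv y = inv k" using k k' x by (simp add: inv_mult_group m_assoc[symmetric])
  then have "phi x \<otimes> inv (phi y) = phi (inv k)"
    using k k' x by (metis phi_inv phi_mult inv_closed m_closed)
  then have "code ((K #> x, False) # w) (phi x) = \<iota> (phi (inv k)) \<otimes>\<^bsub>G\<^esub> (T \<otimes>\<^bsub>G\<^esub> code w y)"
    by (simp add: Let_def y_def[symmetric])
  also have "code w y = \<iota> k \<otimes>\<^bsub>G\<^esub> code w x" using k k' code_mult[OF w] x by simp
  also have "\<iota> (phi (inv k)) \<otimes>\<^bsub>G\<^esub> (T \<otimes>\<^bsub>G\<^esub> (\<iota> k \<otimes>\<^bsub>G\<^esub> code w x))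
      = (\<iota> (phi (inv k)) \<otimes>\<^bsub>G\<^esub> T) \<otimes>\<^bsub>G\<^esub> (\<iota> k \<otimes>\<^bsub>G\<^esub> code w x)"
    using c k' phi_closed by (simp add: G.m_assoc)
  also have "\<dots> = T \<otimes>\<^bsub>G\<^esub> ((\<iota> (inv k) \<otimes>\<^bsub>G\<^esub> \<iota> k) \<otimes>\<^bsub>G\<^esub> code w x)"
    unfolding T_iota[OF k'(1), symmetric] using c k' by (simp add: G.m_assoc)
  also have "\<iota> (inv k) \<otimes>\<^bsub>G\<^esub> \<iota> k = \<one>\<^bsub>G\<^esub>" using k' by (simp add: iota_mult iota_one)
  finally show ?thesis using c by simp
qed

lemma code_push_inv_T:
  assumes w: "fst ` set w \<subseteq> rcosets K" and x: "x \<in> carrier H"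
  shows "code ((K #> x, True) # w) x = inv\<^bsub>G\<^esub> T \<otimes>\<^bsub>G\<^esub> code w (phi x)"
proof -
  define y where "y = (SOME y. y \<in> K #> x)"
  obtain k where k: "k \<in> K" "y = k \<otimes> x"
    using in_coset_K some_in_rcoset(1)[OF coset_in_rcosets[OF x]] y_def by blast
  have k': "inv k \<in> K" "k \<in> carrier H" using k subgroup.m_inv_closed[OF K] K_carrier by auto
  have c: "code w (phi x) \<in> carrier G" using code_closed[OF w phi_closed[OF x]] .
  have "x \<otimes> inv y = inv k" using k k' x by (simp add: inv_mult_group m_assoc[symmetric])
  then have "code ((K #> x, True) # w) x = \<iota> (inv k) \<otimes>\<^bsub>G\<^esub> (inv\<^bsub>G\<^esub> T \<otimes>\<^bsub>G\<^esub> code w (phi y))"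
    by (simp add: Let_def y_def[symmetric])
  also have "code w (phi y) = \<iota> (phi k) \<otimes>\<^bsub>G\<^esub> code w (phi x)"
    using k k' code_mult[OF w] x phi_closed phi_mult by simp
  also have "\<iota> (inv k) \<otimes>\<^bsub>G\<^esub> (inv\<^bsub>G\<^esub> T \<otimes>\<^bsub>G\<^esub> (\<iota> (phi k) \<otimes>\<^bsub>G\<^esub> code w (phi x)))
      = (\<iota> (inv k) \<otimes>\<^bsub>G\<^esub> inv\<^bsub>G\<^esub> T) \<otimes>\<^bsub>G\<^esub> (\<iota> (phi k) \<otimes>\<^bsub>G\<^esub> code w (phi x))"
    using c k' phi_closed by (simp add: G.m_assoc)
  also have "\<dots> = inv\<^bsub>G\<^esub> T \<otimes>\<^bsub>G\<^esub> ((\<iota> (phi (inv k)) \<otimes>\<^bsub>G\<^esub> \<iota> (phi k)) \<otimes>\<^bsub>G\<^esub> code w (phi x))"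
    unfolding inv_T_iota[OF k'(1), symmetric] using c k' phi_closed by (simp add: G.m_assoc)
  also have "\<iota> (phi (inv k)) \<otimes>\<^bsub>G\<^esub> \<iota> (phi k) = \<one>\<^bsub>G\<^esub>"
    using k' phi_closed by (simp add: iota_mult iota_one phi_inv)
  finally show ?thesis using c by simp
qed

lemma push_cases:
  obtains "push (c, e) w = (c, e) # w" | w' where "w = (c, \<not> e) # w'" "push (c, e) w = w'"
proof (cases w)
  case (Cons l v)
  show thesis
  proof (cases "c = fst l \<and> e \<noteq> snd l")
    case True
    show thesis by (rule that(2)[of v]) (use True Cons in \<open>auto simp: prod_eq_iff\<close>)
  next
    case False
    show thesis by (rule that(1)) (use False Cons in auto)
  qed
qed (use that(1) in simp)

text \<open>Equivariance of \<open>code\<close>. A letter that pops the stack undoes the opposite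
  push, so the two push lemmas settle both cases.\<close>

lemma code_step:
  assumes l: "hnn_valid_letter H l" and s: "x \<in> carrier H" "w \<in> stacks"
  shows "code (snd (B.step l (x, w))) (fst (B.step l (x, w))) = cls [l] \<otimes>\<^bsub>G\<^esub> code w x"
proof -
  have w: "fst ` set w \<subseteq> rcosets K" using s unfolding stacks_def by auto
  note c = code_closed[OF w s(1)]
  consider h e where "l = (Some h, e)" "h \<in> carrier H" | "l = (None, False)" | "l = (None, True)"
    using l by (cases l rule: prod.exhaust; cases "fst l"; cases "snd l") auto
  then show ?thesis
  proof cases
    case (1 h e)
    then show ?thesis using code_mult[OF w] s by (cases e) (auto simp: cls_flip iota_inv)
  next
    case 2
    show ?thesis
    proof (rule push_cases[of "K #> x" False w])
      assume "push (K #> x, False) w = (K #> x, False) # w"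
      then show ?thesis using 2 code_push_T[OF w s(1)] by (simp del: code.simps)
    next
      fix w' assume p: "w = (K #> x, \<not> False) # w'" "push (K #> x, False) w = w'"
      then have w': "fst ` set w' \<subseteq> rcosets K" using w by auto
      have "code w x = inv\<^bsub>G\<^esub> T \<otimes>\<^bsub>G\<^esub> code w' (phi x)"
        using code_push_inv_T[OF w' s(1)] p(1) by (simp del: code.simps)
      then have "T \<otimes>\<^bsub>G\<^esub> code w x = code w' (phi x)"
        using code_closed[OF w' phi_closed[OF s(1)]] by (simp add: G.m_assoc[symmetric])
      then show ?thesis using 2 p(2) by simp
    qed
  next
    case 3
    define x' where "x' = psi x"
    have x': "x' \<in> carrier H" "phi x' = x" using psi_closed phi_psi s x'_def by auto
    have T: "cls [l] = inv\<^bsub>G\<^esub> T" using 3 cls_flip by simp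
    show ?thesis
    proof (rule push_cases[of "K #> x'" True w])
      assume "push (K #> x', True) w = (K #> x', True) # w"
      then show ?thesis using 3 code_push_inv_T[OF w x'(1)] T x' by (simp add: x'_def[symmetric] del: code.simps)
    next
      fix w' assume p: "w = (K #> x', \<not> True) # w'" "push (K #> x', True) w = w'"
      then have w': "fst ` set w' \<subseteq> rcosets K" using w by auto
      have "code w x = T \<otimes>\<^bsub>G\<^esub> code w' x'"
        using code_push_T[OF w' x'(1)] p(1) x' by (simp del: code.simps)
      then have "inv\<^bsub>G\<^esub> T \<otimes>\<^bsub>G\<^esub> code w x = code w' x'"
        using code_closed[OF w' x'(1)] by (simp add: G.m_assoc[symmetric])
      then show ?thesis using 3 p(2) T by (simp add: x'_def[symmetric])
    qed
  qed
qed

lemma start_state: "(\<one>, []) \<in> carrier H \<times> stacks"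
  by (simp add: stacks_def)

lemma code_act: "valid u \<Longrightarrow> code (snd (B.act u (\<one>, []))) (fst (B.act u (\<one>, []))) = cls u"
proof (induction u)
  case Nil
  then show ?case by (simp add: iota_one G_one)
next
  case (Cons l u)
  obtain x w where xw: "B.act u (\<one>, []) = (x, w)" "x \<in> carrier H" "w \<in> stacks"
    using B.act_closed[OF _ start_state, of u] Cons.prems by auto
  have "code (snd (B.act (l # u) (\<one>, []))) (fst (B.act (l # u) (\<one>, []))) = cls [l] \<otimes>\<^bsub>G\<^esub> cls u"
    using code_step[of l x w] xw Cons by simp
  then show ?case using Cons.prems by (simp add: G_mult)
qed

text \<open>The stabilizer of the single point \<open>(\<one>, [])\<close> is already trivial, since
  \<open>code\<close> recovers an element from the image of that point. This plays the part of the
  normal form theorem.\<close>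

lemma act_faithful:
  assumes "valid u" "B.act u (\<one>, []) = (\<one>, [])" shows "cls u = \<one>\<^bsub>G\<^esub>"
  using code_act[OF assms(1)] assms(2) by (simp add: iota_one)

end

section \<open>Finite quotients of the action on stacks\<close>

locale hnn_finite_quotient = hnn +
  fixes N :: "'a set" and \<tau> :: "'a set \<Rightarrow> nat \<Rightarrow> nat" and m :: nat
  assumes N: "N \<lhd> H" and phi_N: "phi ` N = N" and \<tau>: "\<tau> c permutes {..m}"
begin

interpretation N: normal N H by (rule N)

lemma lact_coset:
  assumes "h \<in> carrier H" "x \<in> carrier H" shows "h <# (N #> x) = N #> (h \<otimes> x)"
proof -
  have "h <# (N #> x) = (h <# N) #> x" using coset_assoc[OF assms N.subset] by simp
  also have "h <# N = N #> h" using N.coset_eq assms(1) by simp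
  finally show ?thesis using coset_mult_assoc[OF N.subset assms] by simp
qed

lemma phi_coset:
  assumes "x \<in> carrier H" shows "phi ` (N #> x) = N #> phi x"
proof -
  have "phi ` (N #> x) = (\<lambda>n. phi n \<otimes> phi x) ` N"
    unfolding r_coset_def using assms N.mem_carrier phi_mult by (auto simp: image_UN image_iff)
  also have "\<dots> = (\<lambda>n. n \<otimes> phi x) ` phi ` N" by auto
  finally show ?thesis unfolding phi_N r_coset_def by auto
qed

lemma psi_N: "psi ` N = N"
proof -
  have "psi ` phi ` N = N" using psi_phi N.mem_carrier by (force simp: image_iff)
  then show ?thesis using phi_N by simp
qed

lemma psi_coset:
  assumes "x \<in> carrier H" shows "psi ` (N #> x) = N #> psi x"
proof -
  have "psi ` (N #> x) = (\<lambda>n. psi n \<otimes> psi x) ` N"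
    unfolding r_coset_def using assms N.mem_carrier psi_mult by (auto simp: image_UN image_iff)
  also have "\<dots> = (\<lambda>n. n \<otimes> psi x) ` psi ` N" by auto
  finally show ?thesis unfolding psi_N r_coset_def by auto
qed

text \<open>The passage from cosets of \<open>K\<close> to cosets of the product of \<open>K\<close>
  and \<open>N\<close>; it translates letters of a stack into labels for the finite action.\<close>

definition \<nu> :: "'a set \<Rightarrow> 'a set" where "\<nu> c = N <#> c"

lemma \<nu>_coset:
  assumes "x \<in> carrier H" shows "K <#> (N #> x) = \<nu> (K #> x)"
proof -
  have Kc: "K \<subseteq> carrier H" using K subgroup.subset by blast
  have "N <#> K = K <#> N" by (rule commut_normal[symmetric, OF K N])
  then have "N <#> K #> x = K <#> N #> x" by simp
  then show ?thesis unfolding \<nu>_def using setmult_rcos_assoc Kc N.subset assms by simp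
qed

lemma \<nu>_step:
  assumes "k \<in> K" "x \<in> carrier H" shows "K <#> (k <# (N #> x)) = K <#> (N #> x)"
  using assms K_carrier coset_K by (simp add: lact_coset \<nu>_coset)

lemma rcosets_N: "A \<in> rcosets N \<Longrightarrow> \<exists>x\<in>carrier H. A = N #> x"
  unfolding RCOSETS_def by auto

text \<open>The same twist over \<open>H\<close> modulo \<open>N\<close>: t can now see only the
  coset modulo the product of \<open>K\<close> and \<open>N\<close>, and its permutations of the
  fibre are given by \<open>\<tau>\<close>.\<close>

sublocale D: hnn_twist H phi K "rcosets N" "l_coset H" "(`) phi" "(`) psi" "\<lambda>A. K <#> A" "{..m}"
  \<tau> "\<lambda>c. inv_into UNIV (\<tau> c)"
proof unfold_locales
  show "h <# A \<in> rcosets N" if "h \<in> carrier H" "A \<in> rcosets N" for h A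
    using that rcosetsI[OF N.subset] by (auto dest!: rcosets_N simp: lact_coset)
  show "h <# (k <# A) = h \<otimes> k <# A" if "h \<in> carrier H" "k \<in> carrier H" "A \<in> rcosets N" for h k A
    using that by (auto dest!: rcosets_N simp: lact_coset m_assoc)
  show "\<one> <# A = A" if "A \<in> rcosets N" for A
    using that by (auto dest!: rcosets_N simp: lact_coset)
  show "phi ` A \<in> rcosets N" "psi ` A \<in> rcosets N" if "A \<in> rcosets N" for A
    using that rcosetsI[OF N.subset] by (auto dest!: rcosets_N simp: phi_coset psi_coset phi_closed psi_closed)
  show "phi ` psi ` A = A" "psi ` phi ` A = A" if "A \<in> rcosets N" for A
  proof -
    from rcosets_N[OF that] obtain x where x: "x \<in> carrier H" "A = N #> x" by blast
    show "phi ` psi ` A = A" "psi ` phi ` A = A"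
      unfolding x(2) by (simp_all only: x(1) phi_coset psi_coset phi_closed psi_closed phi_psi psi_phi)
  qed
  show "phi ` (h <# A) = phi h <# phi ` A" if "h \<in> carrier H" "A \<in> rcosets N" for h A
  proof -
    from rcosets_N[OF that(2)] obtain x where x: "x \<in> carrier H" "A = N #> x" by blast
    show ?thesis
      unfolding x(2) using that(1) x(1) by (simp only: lact_coset phi_coset phi_closed phi_mult m_closed)
  qed
  show "K <#> (k <# A) = K <#> A" if "k \<in> K" "A \<in> rcosets N" for k A
    using that by (auto dest!: rcosets_N simp only: \<nu>_step)
  show "\<tau> (K <#> A) p \<in> {..m}" "inv_into UNIV (\<tau> (K <#> A)) p \<in> {..m}" if "p \<in> {..m}" for A p
    using that permutes_in_image[OF \<tau>] permutes_in_image[OF permutes_inv[OF \<tau>]] by blast+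
  show "\<tau> (K <#> A) (inv_into UNIV (\<tau> (K <#> A)) p) = p" "inv_into UNIV (\<tau> (K <#> A)) (\<tau> (K <#> A) p) = p" for A p
    using permutes_inverses[OF \<tau>] by auto
qed

text \<open>The equivariant map from stacks to the finite set: a stack is no longer stored but
  applied to \<open>m\<close>, the point at which \<open>reduced_word_acts_nontrivially\<close>
  starts.\<close>

definition \<Phi> :: "'a \<times> ('a set \<times> bool) list \<Rightarrow> 'a set \<times> nat" where
  "\<Phi> s = (N #> fst s, ev (\<tau> \<circ> \<nu>) (snd s) m)"

lemma \<Phi>_step:
  assumes l: "hnn_valid_letter H l" and s: "x \<in> carrier H"
  shows "\<Phi> (B.step l (x, w)) = D.step l (\<Phi> (x, w))"
proof -
  have "bij ((\<tau> \<circ> \<nu>) c)" for c using permutes_bij[OF \<tau>] by simp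
  then have push: "ev (\<tau> \<circ> \<nu>) (push (c, e) v) p
      = (if e then inv_into UNIV ((\<tau> \<circ> \<nu>) c) else (\<tau> \<circ> \<nu>) c) (ev (\<tau> \<circ> \<nu>) v p)" for c e v p
    by (rule ev_push)
  consider h e where "l = (Some h, e)" "h \<in> carrier H" | e where "l = (None, e)"
    using l by (cases l; cases "fst l") auto
  then show ?thesis
  proof cases
    case (1 h e)
    then show ?thesis using s by (cases e) (auto simp: \<Phi>_def lact_coset)
  next
    case (2 e)
    then show ?thesis
      using s psi_closed by (cases e) (auto simp: \<Phi>_def phi_coset psi_coset \<nu>_coset push)
  qed
qed

lemma \<Phi>_act: "valid u \<Longrightarrow> \<Phi> (B.act u (\<one>, [])) = D.act u (\<Phi> (\<one>, []))"
proof (induction u)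
  case (Cons l u)
  obtain x w where xw: "B.act u (\<one>, []) = (x, w)" "x \<in> carrier H"
    using B.act_closed[OF _ start_state, of u] Cons.prems by auto
  then show ?case using Cons \<Phi>_step[of l x w] by simp
qed simp

end

context hnn
begin

text \<open>A nontrivial \<open>g\<close> takes \<open>(\<one>, [])\<close> to another state
  \<open>(x, w)\<close>. If \<open>w\<close> is nonempty, the fibre coordinates \<open>0\<close> and
  \<open>length w\<close> separate the two states in the finite set; if \<open>w\<close> is empty,
  then \<open>x \<noteq> \<one>\<close> and a subgroup avoiding \<open>x\<close> separates
  them.\<close>

theorem residually_finite_HNN:
  assumes fK: "finite K" and F: "finite F" "F \<subseteq> carrier H" "generate H F = carrier H"
    and rf: "residually_finite H"
  shows "residually_finite G"
  unfolding residually_finite_def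
proof (intro ballI impI)
  fix g assume g: "g \<in> carrier G" "g \<noteq> \<one>\<^bsub>G\<^esub>"
  obtain u where u: "valid u" "g = cls u" using g(1) G_carrier by blast
  obtain x w where xw: "B.act u (\<one>, []) = (x, w)" "x \<in> carrier H" "w \<in> stacks"
    using B.act_closed[OF u(1) start_state] by auto
  have nontriv: "(x, w) \<noteq> (\<one>, [])" using act_faithful[OF u(1)] xw(1) u(2) g(2) by metis
  define C where "C = fst ` set w"
  have C: "finite C" "C \<subseteq> rcosets K" and red: "reduced w" using xw(3) unfolding C_def stacks_def by auto
  define y where "y c = (SOME y. y \<in> c)" for c :: "'a set"
  have y: "y c \<in> c" "y c \<in> carrier H" "c = K #> y c" if "c \<in> C" for c
  proof -
    have c: "c \<in> rcosets K" using that C by blast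
    show "y c \<in> c" "y c \<in> carrier H" unfolding y_def using some_in_rcoset[OF c] by auto
    moreover obtain z where "z \<in> carrier H" "c = K #> z" using c unfolding RCOSETS_def by auto
    ultimately show "c = K #> y c" using repr_independence K by metis
  qed
  \<comment> \<open>If the cosets of \<open>y c\<close> and \<open>y c'\<close> merge modulo
    \<open>N\<close>, then \<open>y c = n \<otimes> (k \<otimes> y c')\<close> with \<open>n\<close>
    in \<open>N\<close>, and this \<open>n\<close> is one of the elements listed. Avoiding the
    nontrivial ones forces \<open>n = \<one>\<close> and \<open>c = c'\<close>. So different letters
    of \<open>w\<close> stay different and its image stays reduced.\<close>
  define E where "E = (insert x ((\<lambda>(c, c', k). y c \<otimes> inv (y c') \<otimes> inv k) ` (C \<times> C \<times> K))) - {\<one>}"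
  have fE: "finite E" unfolding E_def using C fK by auto
  have EH: "E \<subseteq> carrier H - {\<one>}" unfolding E_def using y(2) xw(2) K_carrier by auto
  obtain N where N: "N \<lhd> H" "finite (rcosets N)" "phi ` N = N" "N \<inter> E = {}"
    using invariant_finite_index_avoiding[OF F rf phi fE EH] by (elim exE conjE)
  interpret N: normal N H by (rule N(1))
  have inj: "inj_on (\<lambda>c. N <#> c) C"
  proof (rule inj_onI)
    fix c c' assume c: "c \<in> C" "c' \<in> C" "N <#> c = N <#> c'"
    have "\<one> \<otimes> y c \<in> N <#> c" unfolding set_mult_def using y[OF c(1)] N.one_closed by blast
    then have "y c \<in> N <#> (K #> y c')" using c y by simp
    then obtain n k where nk: "n \<in> N" "k \<in> K" "y c = n \<otimes> (k \<otimes> y c')"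
      unfolding set_mult_def r_coset_def by auto
    have carr: "n \<in> carrier H" "k \<in> carrier H" "y c' \<in> carrier H"
      using nk K_carrier N.mem_carrier y c by auto
    have "y c \<otimes> inv (y c') \<otimes> inv k = n"
      unfolding nk(3) using carr by (simp add: m_assoc)
    moreover have "y c \<otimes> inv (y c') \<otimes> inv k \<in> insert \<one> E"
      unfolding E_def using c nk(2) by force
    ultimately have "n = \<one>" using N(4) nk(1) by auto
    then have "y c \<in> K #> y c'" using nk carr unfolding r_coset_def by auto
    then show "c = c'" using y[OF c(1)] y[OF c(2)] repr_independence K by metis
  qed
  define w' where "w' = map (map_prod (\<lambda>c. N <#> c) id) w"
  define m where "m = length w"
  have "reduced w'" unfolding w'_def using reduced_map inj red C_def by blast
  then obtain \<tau> where \<tau>: "\<And>c. \<tau> c permutes {..m}" "ev \<tau> w' m = 0"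
    using reduced_word_acts_nontrivially[of w'] unfolding w'_def m_def by auto
  interpret Q: hnn_finite_quotient H phi K N \<tau> m
    using N(1,3) \<tau>(1) by unfold_locales
  have ev: "ev (\<tau> \<circ> Q.\<nu>) w m = 0"
    using \<tau>(2) unfolding w'_def ev_map Q.\<nu>_def[abs_def] .
  have "Q.\<Phi> (x, w) \<noteq> Q.\<Phi> (\<one>, [])"
  proof
    assume eq: "Q.\<Phi> (x, w) = Q.\<Phi> (\<one>, [])"
    then have "m = 0" using ev by (simp add: Q.\<Phi>_def)
    then have "w = []" by (simp add: m_def)
    then have "x \<in> E" using nontriv unfolding E_def by simp
    moreover have "N #> x = N" using eq N.subset unfolding Q.\<Phi>_def by simp
    then have "x \<in> N" using coset_join1 xw(2) N.subgroup_axioms by blast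
    ultimately show False using N(4) by blast
  qed
  then have moved: "Q.D.gact g (Q.\<Phi> (\<one>, [])) \<noteq> Q.\<Phi> (\<one>, [])"
    if "Q.\<Phi> (\<one>, []) \<in> (rcosets N) \<times> {..m}"
    using Q.\<Phi>_act[OF u(1)] xw(1) Q.D.gact_cls[OF u(1) that] u(2) by simp
  have start: "Q.\<Phi> (\<one>, []) \<in> (rcosets N) \<times> {..m}"
    unfolding Q.\<Phi>_def using rcosetsI[OF N.subset, of \<one>] by simp
  have fin: "finite ((rcosets N) \<times> {..m})" using N(2) by simp
  have "g \<notin> {g \<in> carrier G. \<forall>s\<in>(rcosets N) \<times> {..m}. Q.D.gact g s = s}"
  proof
    assume "g \<in> {g \<in> carrier G. \<forall>s\<in>(rcosets N) \<times> {..m}. Q.D.gact g s = s}"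
    then have "\<forall>s\<in>(rcosets N) \<times> {..m}. Q.D.gact g s = s" by simp
    from bspec[OF this start] show False using moved[OF start] by contradiction
  qed
  then show "\<exists>N. N \<lhd> G \<and> finite (rcosets\<^bsub>G\<^esub> N) \<and> g \<notin> N"
    using Q.D.kernel_finite_index[OF fin] by (intro exI conjI)
qed

end

lemma normalizer_conj:
  assumes "K \<subseteq> carrier H" "n \<in> normalizer H K" "k \<in> K"
  shows "n \<otimes>\<^bsub>H\<^esub> k \<otimes>\<^bsub>H\<^esub> inv\<^bsub>H\<^esub> n \<in> K"
proof -
  have "n <#\<^bsub>H\<^esub> K #>\<^bsub>H\<^esub> inv\<^bsub>H\<^esub> n = K"
    using assms(1,2) unfolding normalizer_def stabilizer_def by auto
  then show "n \<otimes>\<^bsub>H\<^esub> k \<otimes>\<^bsub>H\<^esub> inv\<^bsub>H\<^esub> n \<in> K"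
    using assms(3) unfolding l_coset_def r_coset_def by auto
qed

theorem theoremB:
  fixes H :: "('a, 'b) monoid_scheme" and phi :: "'a \<Rightarrow> 'a" and K :: "'a set"
  assumes "group H"
    and "phi \<in> iso H H"
    and "subgroup K H" and "K \<subset> carrier H"
    and "K \<subset> normalizer H K"
    and "hyperbolic_group (HNN H phi K)"
    and "\<not> residually_finite (HNN H phi K)"
  shows "finite K \<and> hyperbolic_group H \<and> \<not> residually_finite H"
proof -
  interpret hnn H phi K
    using assms(1-3) by (intro hnn.intro hnn_axioms.intro)
  obtain n where n: "n \<in> normalizer H K" "n \<notin> K" using assms(5) by blast
  have nc: "n \<in> carrier H" using n(1) unfolding normalizer_def stabilizer_def by auto
  have "finite K"
    using finite_K[OF assms(6) nc n(2)] normalizer_conj[OF _ n(1)] assms(4) by blast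
  \<comment> \<open>\<open>hyperbolic_base\<close> supplies the finite generating set with which
    residual finiteness of \<open>H\<close> would pass to \<open>G\<close>.\<close>
  then show ?thesis
    using hyperbolic_base[OF _ assms(6)] residually_finite_HNN assms(7) by blast
qed

end
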